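(* Let $w\in S_n$ be an inverse fireworks permutation. There exists a bijection $\Psi:\mathsf{BVPD}(w)\to\widehat{\mathsf{PD}(w)}$ that preserves the positions of weighty tiles, i.e. $\mathsf{wty}(\Psi(B))=\mathsf{wty}(B)$ (as sets of pairs (row, column)) for all $B\in\mathsf{BVPD}(w)$.
   Context: Fix an integer $n\ge 1$. Cells of a grid are written $(i,j)$: row $i$ counted from the top, column $j$ counted from the left, both starting at $1$. Tiles. A cell is filled with one of: the blank tile; the H-tile (one strand joining the left and right edges); the J-tile (one strand joining the left and top edges); the R-tile (one strand joining the bottom and right edges); the bump tile (two strands, one joining left and top, the other joining bottom and right); the cross tile (strands meeting all four edges). Neighbouring tiles must match along shared edges, and in every tiling below pipes enter through the left boundary of the grid and exit through the top boundary (no strand meets the right or bottom boundary). Tracing pipes. The pipe entering from row $p$ is called pipe $p$. Pipes are traced from the left boundary to the top boundary, processing rows from bottom to top and cells in a row from left to right. At a cross tile where pipe $p$ enters from the left and pipe $q$ from the bottom: if $p$ and $q$ have not crossed before, they cross in this tile, $p$ exits right and $q$ exits top; otherwise they do not cross here, $p$ exits top and $q$ exits right. (Equivalently, pipe $\max(p,q)$ exits top.) Pipe dreams. A pipe dream (PD) is such a tiling of the $n\times n$ grid by cross, bump, J- and blank tiles with a pipe entering from every row and exiting from every column (so the J-tiles are exactly at $i+j=n+1$, blanks at $i+j>n+1$, and cross or bump tiles at $i+j\le n$). For $w\in S_n$, $\mathsf{PD}(w)$ is the set of PDs such that for each $c$ the pipe exiting at the top of column $c$ is pipe $w^{-1}(c)$.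 For a PD $P$, $\mathsf{wty}(P)$ is the set of cells that are cross tiles. $\widehat{\mathsf{PD}(w)}$ is the set of $P\in\mathsf{PD}(w)$ with the maximal number of cross tiles among elements of $\mathsf{PD}(w)$. Inverse fireworks. Split the one-line notation of a permutation into its maximal consecutive decreasing runs. The permutation is fireworks if the first numbers of the runs are increasing from left to right; $w$ is inverse fireworks if $w^{-1}$ is fireworks. BVPDs. A bumpless vertical-less pipe dream (BVPD) is such a tiling of the grid with $n$ rows and $n-1$ columns (numbered $1,\dots,n-1$) by blank, H-, cross, J- and R-tiles. Its column-to-row code is the sequence of $n-1$ numbers whose $c$-th entry is $r$ if pipe $r$ exits at the top of column $c$, and $0$ if no pipe exits at column $c$. For inverse fireworks $w$, $\alpha(w)$ is obtained from $(w^{-1}(1),\dots,w^{-1}(n))$ by replacing the first number of each decreasing run by $0$ and then deleting the first entry. $\mathsf{BVPD}(w)$ is the set of BVPDs with column-to-row code $\alpha(w)$. For a BVPD $B$, $\mathsf{wty}(B)$ is the set of cells that are cross, J- or H-tiles. *)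

theory Defs
  imports "HOL-Combinatorics.Permutations"
begin

section \<open>Tiles and tilings\<close>

datatype tile = Blank | HTile | JTile | RTile | Bump | Cross

definition meets_left :: "tile \<Rightarrow> bool" where
  "meets_left t \<longleftrightarrow> t \<in> {HTile, JTile, Bump, Cross}"

definition meets_right :: "tile \<Rightarrow> bool" where
  "meets_right t \<longleftrightarrow> t \<in> {HTile, RTile, Bump, Cross}"

definition meets_top :: "tile \<Rightarrow> bool" where
  "meets_top t \<longleftrightarrow> t \<in> {JTile, Bump, Cross}"

definition meets_bottom :: "tile \<Rightarrow> bool" where
  "meets_bottom t \<longleftrightarrow> t \<in> {RTile, Bump, Cross}"

text \<open>A filling assigns a tile to each cell (row, column), both coordinates starting at 1.
  Cells outside the grid are required to be blank, so that distinct tilings are distinct functions.\<close>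

type_synonym filling = "nat \<times> nat \<Rightarrow> tile"

definition grid :: "nat \<Rightarrow> nat \<Rightarrow> (nat \<times> nat) set" where
  "grid a b = {1..a} \<times> {1..b}"

definition tiling :: "nat \<Rightarrow> nat \<Rightarrow> filling \<Rightarrow> bool" where
  "tiling a b T \<longleftrightarrow>
     (\<forall>x. x \<notin> grid a b \<longrightarrow> T x = Blank) \<and>
     (\<forall>i\<in>{1..a}. \<forall>j\<in>{1..<b}. meets_right (T (i, j)) = meets_left (T (i, j + 1))) \<and>
     (\<forall>i\<in>{1..<a}. \<forall>j\<in>{1..b}. meets_bottom (T (i, j)) = meets_top (T (i + 1, j))) \<and>
     (\<forall>i\<in>{1..a}. 1 \<le> b \<longrightarrow> \<not> meets_right (T (i, b))) \<and>
     (\<forall>j\<in>{1..b}. 1 \<le> a \<longrightarrow> \<not> meets_bottom (T (a, j)))"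


section \<open>Tracing pipes\<close>

text \<open>\<open>trace_tile t l b X\<close> takes the pipes (if any) entering a tile \<open>t\<close> from the left and from the
  bottom and the set \<open>X\<close> of unordered pairs of pipes that have already crossed. It returns
  the pipe exiting right, the pipe exiting top, and the updated set of crossed pairs.
  In a tiling a cross tile always has both incoming pipes; the default branch is irrelevant.\<close>

fun trace_tile ::
  "tile \<Rightarrow> nat option \<Rightarrow> nat option \<Rightarrow> nat set set \<Rightarrow> nat option \<times> nat option \<times> nat set set" where
  "trace_tile Blank l b X = (None, None, X)"
| "trace_tile HTile l b X = (l, None, X)"
| "trace_tile JTile l b X = (None, l, X)"
| "trace_tile RTile l b X = (b, None, X)"
| "trace_tile Bump l b X = (b, l, X)"
| "trace_tile Cross l b X =
     (case (l, b) of
        (Some p, Some q) \<Rightarrow>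
          if {p, q} \<notin> X then (Some p, Some q, insert {p, q} X)
          else (Some q, Some p, X)
      | _ \<Rightarrow> (l, b, X))"

text \<open>In \<open>(v, h, X)\<close>, \<open>v j\<close> is the pipe on the horizontal edge in column \<open>j\<close> last reached
  (the bottom edge of an unprocessed cell, the top edge of a processed one), and \<open>h\<close> is the pipe
  on the vertical edge to the left of the cell to be processed next.\<close>

definition trace_cell ::
  "filling \<Rightarrow> nat \<Rightarrow> nat \<Rightarrow> (nat \<Rightarrow> nat option) \<times> nat option \<times> nat set set
     \<Rightarrow> (nat \<Rightarrow> nat option) \<times> nat option \<times> nat set set" where
  "trace_cell T i j = (\<lambda>(v, h, X).
     let (r, t, X') = trace_tile (T (i, j)) h (v j) X in (v(j := t), r, X'))"

definition trace_row ::
  "nat \<Rightarrow> filling \<Rightarrow> nat \<Rightarrow> (nat \<Rightarrow> nat option) \<times> nat set set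
     \<Rightarrow> (nat \<Rightarrow> nat option) \<times> nat set set" where
  "trace_row b T i = (\<lambda>(v, X).
     let (v', h', X') = fold (trace_cell T i) [1..<b + 1]
                          (v, if meets_left (T (i, 1)) then Some i else None, X)
     in (v', X'))"

definition exit_pipe :: "nat \<Rightarrow> nat \<Rightarrow> filling \<Rightarrow> nat \<Rightarrow> nat option" where
  "exit_pipe a b T = fst (fold (trace_row b T) (rev [1..<a + 1]) (\<lambda>_. None, {}))"


section \<open>Pipe dreams\<close>

definition pipe_dream :: "nat \<Rightarrow> filling \<Rightarrow> bool" where
  "pipe_dream n P \<longleftrightarrow>
     tiling n n P \<and>
     (\<forall>x\<in>grid n n. P x \<in> {Cross, Bump, JTile, Blank}) \<and>
     (\<forall>i\<in>{1..n}. meets_left (P (i, 1))) \<and>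
     (\<forall>j\<in>{1..n}. meets_top (P (1, j)))"

definition PD :: "nat \<Rightarrow> (nat \<Rightarrow> nat) \<Rightarrow> filling set" where
  "PD n w = {P. pipe_dream n P \<and> (\<forall>c\<in>{1..n}. exit_pipe n n P c = Some (inv w c))}"

definition wty_PD :: "nat \<Rightarrow> filling \<Rightarrow> (nat \<times> nat) set" where
  "wty_PD n P = {x \<in> grid n n. P x = Cross}"

definition PD_hat :: "nat \<Rightarrow> (nat \<Rightarrow> nat) \<Rightarrow> filling set" where
  "PD_hat n w = {P \<in> PD n w. \<forall>Q\<in>PD n w. card (wty_PD n Q) \<le> card (wty_PD n P)}"


section \<open>Inverse fireworks permutations\<close>

definition one_line :: "nat \<Rightarrow> (nat \<Rightarrow> nat) \<Rightarrow> nat list" where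
  "one_line n w = map w [1..<n + 1]"

text \<open>The maximal consecutive decreasing runs of a list, from left to right
  (the recursive call below never returns \<open>[]\<close>).\<close>

fun dec_runs :: "nat list \<Rightarrow> nat list list" where
  "dec_runs [] = []"
| "dec_runs [x] = [[x]]"
| "dec_runs (x # y # xs) =
     (if x > y then (case dec_runs (y # xs) of [] \<Rightarrow> [[x]] | r # rs \<Rightarrow> (x # r) # rs)
      else [x] # dec_runs (y # xs))"

definition fireworks :: "nat \<Rightarrow> (nat \<Rightarrow> nat) \<Rightarrow> bool" where
  "fireworks n w \<longleftrightarrow> sorted_wrt (<) (map hd (dec_runs (one_line n w)))"

definition inverse_fireworks :: "nat \<Rightarrow> (nat \<Rightarrow> nat) \<Rightarrow> bool" where
  "inverse_fireworks n w \<longleftrightarrow> fireworks n (inv w)"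

definition alpha :: "nat \<Rightarrow> (nat \<Rightarrow> nat) \<Rightarrow> nat list" where
  "alpha n w = tl (concat (map (\<lambda>r. 0 # tl r) (dec_runs (one_line n (inv w)))))"


section \<open>Bumpless vertical-less pipe dreams\<close>

definition bvpd :: "nat \<Rightarrow> filling \<Rightarrow> bool" where
  "bvpd n B \<longleftrightarrow>
     tiling n (n - 1) B \<and>
     (\<forall>x\<in>grid n (n - 1). B x \<in> {Blank, HTile, Cross, JTile, RTile})"

definition column_to_row_code :: "nat \<Rightarrow> filling \<Rightarrow> nat list" where
  "column_to_row_code n B =
     map (\<lambda>c. case exit_pipe n (n - 1) B c of None \<Rightarrow> 0 | Some r \<Rightarrow> r) [1..<n]"

definition BVPD :: "nat \<Rightarrow> (nat \<Rightarrow> nat) \<Rightarrow> filling set" where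
  "BVPD n w = {B. bvpd n B \<and> column_to_row_code n B = alpha n w}"

definition wty_BVPD :: "nat \<Rightarrow> filling \<Rightarrow> (nat \<times> nat) set" where
  "wty_BVPD n B = {x \<in> grid n (n - 1). B x \<in> {Cross, JTile, HTile}}"

end

theory Submission
  imports Defs
begin

text \<open>
  Both kinds of tilings are determined by their weighty cells, so it suffices to show that the two
  families of weighty cell sets coincide; both will be the family \<open>tight_sets n (inv w)\<close>.

  Rows are read from bottom to top. After \<open>k\<close> rows of a pipe dream the top edges of the current row
  carry a word \<open>s\<close> of length \<open>k\<close>. The next row lets a new pipe, smaller than all entries of \<open>s\<close>,
  travel to the right; at each cell the travelling pipe \<open>h\<close> meets \<open>s\<^sub>j\<close>, a bump emits \<open>h\<close> upwards, and a
  cross emits the maximum of the two.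

  Give a word the weight \<open>\<Sum>(p - 1)\<close> over the positions \<open>p\<close> of its left-to-right maxima. One row raises
  the weight by at most the number of its bumps (\<open>lr_weight_step\<close>), with equality exactly if the row is
  \<^emph>\<open>tight\<close>: every bump receives a left-to-right maximum of \<open>s\<close> from below, and no cross directly after
  a bump does. Summed over the rows this bounds the number of crosses of a pipe dream of \<open>w\<close> from above, and the
  bound is attained exactly by the pipe dreams all of whose rows are tight. If \<open>inv w\<close> is fireworks, then
  such a pipe dream exists: strip the smallest entries off \<open>inv w\<close> one after the other
  (\<open>tight_rows_exist\<close>). Hence the maximal pipe dreams are the tight ones.

  A word is fireworks iff each of its ascents leads to a left-to-right maximum, and tight rows preserve
  this property. For fireworks words tightness becomes a condition on the descents of \<open>s\<close>:
  if \<open>s\<^sub>j > s\<^sub>j\<^sub>+\<^sub>1\<close>, then cell \<open>j + 1\<close> is weighty, and a weighty cell directly after a cell that is not weighty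
  comes from such a descent. Those are the rules by which the bumpless tiles fit together if the bottom
  edge in column \<open>j\<close> carries the descent bottom \<open>s\<^sub>j\<^sub>+\<^sub>1\<close>, or no pipe when there is no descent at \<open>j\<close>. The tiles
  move this partial word to the partial word of the next state (\<open>route_descent_bottom\<close>), so bumpless tilings
  and tight pipe dreams run in parallel. At the top, the bumpless tiling shows the descent bottoms of
  the final word, and these determine a fireworks permutation.
\<close>

section \<open>One row of a pipe dream\<close>

text \<open>
  The row has crosses in the columns \<open>R\<close> and bumps elsewhere, the pipe \<open>i\<close> enters from the left and \<open>s\<close>
  from below; \<open>carry i R s j\<close> leaves cell \<open>j\<close> to the right and \<open>emit i R s j\<close> leaves it at the top.
  Minimum and maximum cover both the pairs that cross for the first time and those that have crossed
  before. The J-tile closing a row counts as a bump, which emits the travelling pipe in the same way.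
\<close>

primrec carry :: "nat \<Rightarrow> nat set \<Rightarrow> (nat \<Rightarrow> nat) \<Rightarrow> nat \<Rightarrow> nat" where
  "carry i R s 0 = i"
| "carry i R s (Suc j) = (if Suc j \<in> R then min (carry i R s j) (s (Suc j)) else s (Suc j))"

definition emit :: "nat \<Rightarrow> nat set \<Rightarrow> (nat \<Rightarrow> nat) \<Rightarrow> nat \<Rightarrow> nat" where
  "emit i R s j = (if j \<in> R then max (carry i R s (j - 1)) (s j) else carry i R s (j - 1))"

definition lr_max :: "(nat \<Rightarrow> nat) \<Rightarrow> nat \<Rightarrow> bool" where
  "lr_max s p \<longleftrightarrow> (\<forall>q\<in>{1..<p}. s q < s p)"

definition ascents_lr_max :: "nat \<Rightarrow> (nat \<Rightarrow> nat) \<Rightarrow> bool" where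
  "ascents_lr_max k s \<longleftrightarrow> (\<forall>j\<in>{1..<k}. s j < s (Suc j) \<longrightarrow> lr_max s (Suc j))"

text \<open>Left-to-right maxima of \<open>s\<close> are the only places where a bump costs as much as it gains in
  \<open>lr_weight\<close>. Given that, a cross with such a maximum wastes weight exactly if the travelling pipe
  exceeds all pipes emitted before, which it does directly after a bump. It also does in column 1, but
  there the waste is \<open>0\<close>, whence the second condition starts in column 2.\<close>

definition tight :: "nat \<Rightarrow> nat set \<Rightarrow> (nat \<Rightarrow> nat) \<Rightarrow> bool" where
  "tight k R s \<longleftrightarrow>
     (\<forall>j\<in>{1..k}. j \<notin> R \<longrightarrow> lr_max s j) \<and>
     (\<forall>j\<in>{1..<k}. j \<notin> R \<and> Suc j \<in> R \<longrightarrow> \<not> lr_max s (Suc j))"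

text \<open>Every cell permutes the two pipes meeting in it, so no pipe is lost or duplicated.\<close>

lemma carry_emit_image:
  "insert (carry i R s j) (emit i R s ` {1..j}) = insert i (s ` {1..j})"
proof (induction j)
  case (Suc j)
  have ins: "{1..Suc j} = insert (Suc j) {1..j}" by auto
  have "insert (carry i R s (Suc j)) (insert (emit i R s (Suc j)) E) =
      insert (s (Suc j)) (insert (carry i R s j) E)" for E
    by (auto simp: emit_def max_def min_def)
  then show ?case using Suc unfolding ins image_insert by auto
qed simp

lemma emit_image:
  assumes "Suc k \<notin> R"
  shows "emit i R s ` {1..Suc k} = insert i (s ` {1..k})"
proof -
  have "{1..Suc k} = insert (Suc k) {1..k}" by auto
  then show ?thesis using carry_emit_image[of i R s k] assms by (simp add: emit_def)
qed

lemma carry_cong: "(\<And>c. c \<in> {1..j} \<Longrightarrow> s c = s' c) \<Longrightarrow> carry i R s j = carry i R s' j"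
  by (induction j) auto

lemma emit_cong:
  assumes "\<And>c. c \<in> {1..k} \<Longrightarrow> s c = s' c" "Suc k \<notin> R" "c \<in> {1..Suc k}"
  shows "emit i R s c = emit i R s' c"
proof -
  have "carry i R s (c - 1) = carry i R s' (c - 1)"
    using assms by (intro carry_cong) auto
  moreover have "c \<in> R \<Longrightarrow> s c = s' c" using assms by (cases "c = Suc k") auto
  ultimately show ?thesis by (simp add: emit_def)
qed

lemma lr_max_cong: "(\<And>c. c \<in> {1..p} \<Longrightarrow> s c = s' c) \<Longrightarrow> p \<ge> 1 \<Longrightarrow> lr_max s p = lr_max s' p"
  by (auto simp: lr_max_def)

lemma tight_cong: "(\<And>c. c \<in> {1..k} \<Longrightarrow> s c = s' c) \<Longrightarrow> tight k R s = tight k R s'"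
proof -
  assume a: "\<And>c. c \<in> {1..k} \<Longrightarrow> s c = s' c"
  then have "lr_max s p = lr_max s' p" if "p \<in> {1..k}" for p
    using that by (intro lr_max_cong) auto
  then show ?thesis unfolding tight_def by (auto simp: Ball_def)
qed

text \<open>As rows are read from bottom to top, the entering pipe is smaller than all pipes met in the row.\<close>

locale row =
  fixes i k :: nat and R :: "nat set" and s :: "nat \<Rightarrow> nat"
  assumes cells: "R \<subseteq> {1..k}"
    and newest: "\<And>c. c \<in> {1..k} \<Longrightarrow> i < s c"
    and inj: "inj_on s {1..k}"
begin

abbreviation "h \<equiv> carry i R s"
abbreviation "out \<equiv> emit i R s"

text \<open>
  Whether the travelling pipe exceeds everything emitted so far; together with the left-to-right maxima of
  \<open>s\<close> this single bit determines the left-to-right maxima of the emitted word.\<close>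

definition carry_max :: "nat \<Rightarrow> bool" where
  "carry_max j \<longleftrightarrow> (\<forall>q\<in>{1..j}. out q < h j)"

lemma lr_max_iff:
  assumes "j < k"
  shows "lr_max s (Suc j) \<longleftrightarrow> (\<forall>x\<in>insert (h j) (out ` {1..j}). x < s (Suc j))"
  unfolding carry_emit_image using newest[of "Suc j"] assms
  by (auto simp: lr_max_def)

lemma distinct_step:
  assumes "j < k"
  shows "s (Suc j) \<notin> insert (h j) (out ` {1..j})"
  unfolding carry_emit_image
proof -
  have "s (Suc j) \<noteq> s c" if "c \<in> {1..j}" for c
    using inj_onD[OF inj, of "Suc j" c] that assms by auto
  then show "s (Suc j) \<notin> insert i (s ` {1..j})" using newest[of "Suc j"] assms by fastforce
qed

lemma carry_less_emit:
  assumes "j \<in> R"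
  shows "h j < out j"
proof -
  obtain j' where j': "j = Suc j'" "j' < k" using assms cells by (cases j) auto
  show ?thesis using distinct_step[OF j'(2)] assms by (auto simp: emit_def j')
qed

text \<open>After a cross the larger pipe has just been emitted; after a bump the travelling pipe is the entry
  of \<open>s\<close> below, which exceeds all earlier pipes iff it is a left-to-right maximum.\<close>

lemma carry_max_Suc:
  assumes "j < k"
  shows "carry_max (Suc j) \<longleftrightarrow> Suc j \<notin> R \<and> lr_max s (Suc j)"
proof (cases "Suc j \<in> R")
  case True
  have "Suc j \<in> {1..Suc j}" by simp
  then have "\<not> carry_max (Suc j)" using carry_less_emit[OF True] unfolding carry_max_def
    by (meson less_asym)
  then show ?thesis using True by simp
next
  case False
  have "{1..Suc j} = insert (Suc j) {1..j}" by auto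
  then show ?thesis using False unfolding carry_max_def lr_max_iff[OF assms]
    by (auto simp: emit_def[of i R s "Suc j"])
qed

lemma carry_max_0: "carry_max 0"
  by (simp add: carry_max_def)

lemma lr_max_emit_bump: "Suc j \<notin> R \<Longrightarrow> lr_max out (Suc j) \<longleftrightarrow> carry_max j"
  by (auto simp: lr_max_def carry_max_def emit_def[of i R s "Suc j"])

text \<open>The emitted maximum exceeds everything before it iff one of the two pipes in the cell does: the
  pipes seen so far are the emitted ones and the travelling one.\<close>

lemma lr_max_emit_cross:
  assumes "Suc j \<in> R"
  shows "lr_max out (Suc j) \<longleftrightarrow> lr_max s (Suc j) \<or> carry_max j"
proof -
  have "j < k" using assms cells by auto
  have "lr_max out (Suc j) \<longleftrightarrow> (\<forall>q\<in>{1..j}. out q < max (h j) (s (Suc j)))"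
    using assms by (auto simp: lr_max_def emit_def[of i R s "Suc j"])
  also have "\<dots> \<longleftrightarrow> lr_max s (Suc j) \<or> carry_max j"
    unfolding lr_max_iff[OF \<open>j < k\<close>] carry_max_def
    using distinct_step[OF \<open>j < k\<close>] by (auto simp: max_def)
  finally show ?thesis .
qed

end

definition lr_weight :: "nat \<Rightarrow> (nat \<Rightarrow> nat) \<Rightarrow> nat" where
  "lr_weight k s = (\<Sum>p\<in>{1..k}. if lr_max s p then p - 1 else 0)"

context row begin

text \<open>In the middle of a row the travelling pipe is counted as if it were emitted next; this makes the
  inequality provable cell by cell. A bump leaves a gap of \<open>1\<close> unless \<open>s\<close> has a maximum there, and a cross
  leaves a gap only if both pipes in the cell exceed all earlier ones.\<close>

lemma lr_weight_step_partial:
  assumes "j \<le> k"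
  shows "lr_weight j out + (if carry_max j then j else 0) \<le> lr_weight j s + card ({1..j} - R) \<and>
    (lr_weight j out + (if carry_max j then j else 0) = lr_weight j s + card ({1..j} - R)
       \<longleftrightarrow> tight j R s)"
  using assms
proof (induction j)
  case 0
  then show ?case by (simp add: lr_weight_def tight_def)
next
  case (Suc j)
  let ?b = "if carry_max j then j else 0"
  have w: "lr_weight (Suc j) f = lr_weight j f + (if lr_max f (Suc j) then j else 0)" for f
    by (simp add: lr_weight_def)
  have ins: "{1..Suc j} = insert (Suc j) {1..j}" by auto
  have IH: "lr_weight j out + ?b \<le> lr_weight j s + card ({1..j} - R)"
    "(lr_weight j out + ?b = lr_weight j s + card ({1..j} - R)) \<longleftrightarrow> tight j R s"
    using Suc by auto
  have T: "tight (Suc j) R s \<longleftrightarrow> tight j R s \<and> (Suc j \<notin> R \<longrightarrow> lr_max s (Suc j)) \<and>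
      (1 \<le> j \<and> j \<notin> R \<and> Suc j \<in> R \<longrightarrow> \<not> lr_max s (Suc j))"
  proof -
    have "{1..<Suc j} = (if 1 \<le> j then insert j {1..<j} else {1..<j})" by auto
    then show ?thesis unfolding tight_def ins by (auto split: if_splits)
  qed
  show ?case
  proof (cases "Suc j \<in> R")
    case False
    have c: "card ({1..Suc j} - R) = Suc (card ({1..j} - R))"
      unfolding ins using False by (simp add: insert_Diff_if)
    then show ?thesis
      using IH T False Suc.prems unfolding w c
      by (auto simp: lr_max_emit_bump carry_max_Suc)
  next
    case True
    have c: "card ({1..Suc j} - R) = card ({1..j} - R)"
      unfolding ins using True by (simp add: insert_Diff_if)
    have cm: "carry_max j \<longleftrightarrow> j = 0 \<or> (j \<notin> R \<and> lr_max s j)"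
      using carry_max_Suc[of "j - 1"] carry_max_0 Suc.prems by (cases j) auto
    have "tight j R s \<Longrightarrow> 1 \<le> j \<Longrightarrow> j \<notin> R \<Longrightarrow> lr_max s j"
      by (auto simp: tight_def)
    then have T': "tight (Suc j) R s \<longleftrightarrow> tight j R s \<and> (0 < j \<and> carry_max j \<longrightarrow> \<not> lr_max s (Suc j))"
      using T True cm by auto
    show ?thesis
      using IH T' True Suc.prems unfolding w c
      by (auto simp: lr_max_emit_cross carry_max_Suc)
  qed
qed

lemma lr_weight_step:
  shows "lr_weight (Suc k) out \<le> lr_weight k s + card ({1..k} - R)"
    and "lr_weight (Suc k) out = lr_weight k s + card ({1..k} - R) \<longleftrightarrow> tight k R s"
proof -
  have "Suc k \<notin> R" using cells by auto
  then have "lr_weight (Suc k) out = lr_weight k out + (if carry_max k then k else 0)"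
    by (simp add: lr_weight_def lr_max_emit_bump)
  then show "lr_weight (Suc k) out \<le> lr_weight k s + card ({1..k} - R)"
    and "lr_weight (Suc k) out = lr_weight k s + card ({1..k} - R) \<longleftrightarrow> tight k R s"
    using lr_weight_step_partial[of k] by auto
qed

lemma tight_carry_max:
  assumes "tight k R s" "j \<in> {1..k}" "j \<notin> R"
  shows "carry_max j"
  using assms carry_max_Suc[of "j - 1"] by (auto simp: tight_def)

text \<open>An ascent of the emitted word cannot follow a cross and end in a bump. If it joins two crosses, it is
  an ascent of \<open>s\<close>; if it starts at a bump, tightness puts a new maximum into the travelling pipe.\<close>

lemma ascents_lr_max_step:
  assumes fw: "ascents_lr_max k s" and t: "tight k R s"
  shows "ascents_lr_max (Suc k) out"
  unfolding ascents_lr_max_def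
proof (intro ballI impI)
  fix j assume j: "j \<in> {1..<Suc k}" and a: "out j < out (Suc j)"
  show "lr_max out (Suc j)"
  proof (cases "j \<in> R")
    case False
    then have "carry_max j" using tight_carry_max[OF t] j by auto
    then show ?thesis using lr_max_emit_bump lr_max_emit_cross by blast
  next
    case True
    have c: "h j < out j" using carry_less_emit[OF True] .
    then have r: "Suc j \<in> R" using a by (auto simp: emit_def split: if_splits)
    then have "Suc j \<le> k" using cells by auto
    have "s (Suc j) > out j" using a r c by (auto simp: emit_def[of i R s "Suc j"] max_def split: if_splits)
    moreover have "out j \<ge> s j" using True by (simp add: emit_def)
    ultimately have "lr_max s (Suc j)"
      using fw j \<open>Suc j \<le> k\<close> by (auto simp: ascents_lr_max_def)
    then show ?thesis using lr_max_emit_cross[OF r] by simp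
  qed
qed

end

section \<open>The state after several rows\<close>

text \<open>Rows are indexed by the number \<open>k\<close> of rows below them, which is also the number of cells of the row
  left of its J-tile.\<close>

definition row_cells :: "nat \<Rightarrow> (nat \<times> nat) set \<Rightarrow> nat \<Rightarrow> nat set" where
  "row_cells n D k = {j. (n - k, j) \<in> D}"

text \<open>Only the entries \<open>1, \<dots>, k\<close> of \<open>state n R k\<close> are meaningful; the initial value is arbitrary.\<close>

primrec state :: "nat \<Rightarrow> (nat \<Rightarrow> nat set) \<Rightarrow> nat \<Rightarrow> nat \<Rightarrow> nat" where
  "state n R 0 = (\<lambda>_. 0)"
| "state n R (Suc k) = emit (n - k) (R k) (state n R k)"

lemma state_cong: "(\<And>k'. k' < k \<Longrightarrow> R k' = R' k') \<Longrightarrow> state n R k = state n R' k"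
  by (induction k) auto

lemma inj_on_if_image:
  assumes "s ` {1..k} = {Suc (n - k)..n}" "k \<le> n"
  shows "inj_on s {1..k::nat}"
  using assms by (intro eq_card_imp_inj_on) auto

lemma row_if_image:
  assumes "s ` {1..k} = {Suc (n - k)..n}" "k \<le> n" "R \<subseteq> {1..k}"
  shows "row (n - k) k R s"
proof
  fix c assume "c \<in> {1..k}"
  then have "s c \<in> {Suc (n - k)..n}" using assms(1) by blast
  then show "n - k < s c" by simp
qed (use assms inj_on_if_image in auto)

lemma state_image:
  assumes "\<And>k. k < n \<Longrightarrow> R k \<subseteq> {1..k}" "k \<le> n"
  shows "state n R k ` {1..k} = {Suc (n - k)..n}"
  using assms(2)
proof (induction k)
  case (Suc k)
  have "Suc k \<notin> R k" using assms(1)[of k] Suc.prems by auto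
  then have "state n R (Suc k) ` {1..Suc k} = insert (n - k) {Suc (n - k)..n}"
    using Suc emit_image[of k "R k" "n - k" "state n R k"] by simp
  also have "\<dots> = {Suc (n - Suc k)..n}" using Suc.prems by auto
  finally show ?case .
qed simp

lemma row_state:
  assumes "\<And>k. k < n \<Longrightarrow> R k \<subseteq> {1..k}" "k < n"
  shows "row (n - k) k (R k) (state n R k)"
  using assms state_image[of n R k] by (intro row_if_image) auto

lemma lr_weight_state:
  assumes R: "\<And>k. k < n \<Longrightarrow> R k \<subseteq> {1..k}" and "m \<le> n"
  shows "lr_weight m (state n R m) \<le> (\<Sum>k<m. card ({1..k} - R k)) \<and>
    (lr_weight m (state n R m) = (\<Sum>k<m. card ({1..k} - R k))
      \<longleftrightarrow> (\<forall>k<m. tight k (R k) (state n R k)))"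
  using assms(2)
proof (induction m)
  case 0
  then show ?case by (simp add: lr_weight_def)
next
  case (Suc m)
  interpret row "n - m" m "R m" "state n R m"
    using Suc.prems by (intro row_state R) auto
  show ?case using Suc lr_weight_step by (auto simp: less_Suc_eq)
qed

lemma ascents_lr_max_state:
  assumes R: "\<And>k. k < n \<Longrightarrow> R k \<subseteq> {1..k}" and "m \<le> n"
    and "\<And>k. k < m \<Longrightarrow> tight k (R k) (state n R k)"
  shows "ascents_lr_max m (state n R m)"
  using assms(2,3)
proof (induction m)
  case 0
  then show ?case by (simp add: ascents_lr_max_def)
next
  case (Suc m)
  interpret row "n - m" m "R m" "state n R m"
    using Suc.prems by (intro row_state R) auto
  show ?case using Suc ascents_lr_max_step by auto
qed

section \<open>A tight set of cells for every fireworks word\<close>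

text \<open>Deleting the smallest entry, at position \<open>p\<close>, keeps a word fireworks, since the entry
  following it is an ascent top and hence a left-to-right maximum. The row that puts it back lets
  it cross everything before position \<open>p\<close>, and from there on bumps at the left-to-right maxima only:
  inside a decreasing run the travelling pipe is the previous entry, so that a cross acts as a shift.\<close>

lemma tight_row_exists:
  assumes im: "u ` {1..Suc k} = {n - k..n}" and "k < n" and fw: "ascents_lr_max (Suc k) u"
  obtains R s where "R \<subseteq> {1..k}" "s ` {1..k} = {Suc (n - k)..n}" "ascents_lr_max k s"
    "tight k R s" "\<And>c. c \<in> {1..Suc k} \<Longrightarrow> emit (n - k) R s c = u c"
proof -
  let ?i = "n - k"
  have "?i \<in> u ` {1..Suc k}" using im by simp
  then obtain p where p: "p \<in> {1..Suc k}" "u p = ?i" by auto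
  have inj: "inj_on u {1..Suc k}" using im \<open>k < n\<close> by (intro eq_card_imp_inj_on) auto
  have small: "?i < u c" if "c \<in> {1..Suc k}" "c \<noteq> p" for c
  proof -
    have "u c \<in> {n - k..n}" using im that by blast
    moreover have "u c \<noteq> u p" using inj_onD[OF inj, of c p] that p by auto
    ultimately show ?thesis using p by auto
  qed
  have asc: "lr_max u (Suc j)" if "j \<in> {1..k}" "u j < u (Suc j)" for j
    using fw that by (auto simp: ascents_lr_max_def)
  define s where "s j = (if j < p then u j else u (Suc j))" for j
  define R where "R = {j. 1 \<le> j \<and> j \<le> k \<and> (j < p \<or> \<not> lr_max s j)}"
  have lr1: "lr_max s j" if "j < p" "lr_max u j" for j
    using that by (auto simp: lr_max_def s_def)
  have lr2: "lr_max s j" if "p \<le> j" "lr_max u (Suc j)" for j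
    using that by (auto simp: lr_max_def s_def)
  have fs: "lr_max s (Suc j)" if "j \<in> {1..<k}" "s j < s (Suc j)" for j
  proof -
    consider "Suc j < p" | "Suc j = p" | "p \<le> j" by linarith
    then show ?thesis
    proof cases
      case 1
      then show ?thesis using that asc[of j] lr1[of "Suc j"] by (auto simp: s_def)
    next
      case 2
      then have "u p < u (Suc p)" using small[of "Suc p"] that p by auto
      then show ?thesis using 2 that asc[of p] lr2[of p] by auto
    next
      case 3
      then show ?thesis using that asc[of "Suc j"] lr2[of "Suc j"] by (auto simp: s_def)
    qed
  qed
  have lrp: "lr_max s p" if "p \<le> k"
    using small[of "Suc p"] that p asc[of p] lr2[of p] by auto
  \<comment> \<open>Before \<open>p\<close> the minimum travels through crosses; from \<open>p\<close> on the travelling pipe is always the previous entry.\<close>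
  have carry1: "carry ?i R s j = ?i" if "j < p" for j
    using that
  proof (induction j)
    case (Suc j)
    have "?i < s (Suc j)" using small[of "Suc j"] Suc.prems p by (auto simp: s_def)
    moreover have "Suc j \<in> R" using Suc.prems p by (auto simp: R_def)
    ultimately show ?case using Suc by simp
  qed simp
  have desc: "s (Suc j) < s j" if "p \<le> j" "Suc j \<in> R" for j
  proof -
    have "\<not> s j < s (Suc j)" using that fs[of j] p by (auto simp: R_def)
    moreover have "u (Suc j) \<noteq> u (Suc (Suc j))"
      using that p inj_onD[OF inj, of "Suc j" "Suc (Suc j)"] by (auto simp: R_def)
    ultimately show ?thesis using that by (auto simp: s_def)
  qed
  have carry2: "carry ?i R s j = s j" if "p \<le> j" "j \<le> k" for j
    using that
  proof (induction j)
    case 0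
    then show ?case using p by auto
  next
    case (Suc j)
    show ?case
    proof (cases "p = Suc j")
      case True
      then show ?thesis using lrp Suc.prems by (auto simp: R_def)
    next
      case False
      then show ?thesis using Suc desc[of j] by auto
    qed
  qed
  have em: "emit ?i R s c = u c" if "c \<in> {1..Suc k}" for c
  proof -
    consider "c < p" | "c = p" | "p < c" by linarith
    then show ?thesis
    proof cases
      case 1
      then have "c \<in> R" "?i < u c" using that p small[of c] by (auto simp: R_def)
      then show ?thesis using 1 carry1[of "c - 1"] by (auto simp: emit_def s_def)
    next
      case 2
      then have "c \<notin> R" using lrp by (auto simp: R_def)
      then show ?thesis using 2 p carry1[of "c - 1"] by (auto simp: emit_def)
    next
      case 3
      then have "carry ?i R s (c - 1) = u c" using carry2[of "c - 1"] that by (auto simp: s_def)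
      moreover have "s c < u c" if "c \<in> R"
      proof -
        have "s (c - 1) = u c" using 3 by (auto simp: s_def)
        then show ?thesis using desc[of "c - 1"] 3 that by auto
      qed
      ultimately show ?thesis by (auto simp: emit_def)
    qed
  qed
  have "s ` {1..k} = u ` ({1..Suc k} - {p})"
  proof
    show "s ` {1..k} \<subseteq> u ` ({1..Suc k} - {p})" by (auto simp: s_def)
    have "u c \<in> s ` {1..k}" if "c \<in> {1..Suc k}" "c \<noteq> p" for c
    proof (cases "c < p")
      case True
      then show ?thesis using that p by (intro image_eqI[of _ _ c]) (auto simp: s_def)
    next
      case False
      then show ?thesis using that p by (intro image_eqI[of _ _ "c - 1"]) (auto simp: s_def)
    qed
    then show "u ` ({1..Suc k} - {p}) \<subseteq> s ` {1..k}" by blast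
  qed
  also have "\<dots> = {n - k..n} - {n - k}"
    using inj_on_image_set_diff[OF inj, of "{1..Suc k}" "{p}"] p im by auto
  also have "\<dots> = {Suc (n - k)..n}" by auto
  finally have ims: "s ` {1..k} = {Suc (n - k)..n}" .
  have "\<not> lr_max s (Suc j)" if "j \<in> {1..<k}" "j \<notin> R" "Suc j \<in> R" for j
    using that by (auto simp: R_def)
  moreover have "lr_max s j" if "j \<in> {1..k}" "j \<notin> R" for j
    using that by (auto simp: R_def)
  ultimately have "tight k R s" unfolding tight_def by blast
  moreover have "R \<subseteq> {1..k}" by (auto simp: R_def)
  moreover have "ascents_lr_max k s" using fs by (auto simp: ascents_lr_max_def)
  ultimately show thesis using that ims em by blast
qed

lemma tight_rows_exist:
  assumes "u ` {1..m} = {Suc (n - m)..n}" "m \<le> n" "ascents_lr_max m u"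
  shows "\<exists>R. (\<forall>k<m. R k \<subseteq> {1..k} \<and> tight k (R k) (state n R k)) \<and>
    (\<forall>c\<in>{1..m}. state n R m c = u c)"
  using assms
proof (induction m arbitrary: u)
  case (Suc m)
  have "u ` {1..Suc m} = {n - m..n}" using Suc.prems by (simp add: Suc_diff_Suc)
  then obtain Q s where Q: "Q \<subseteq> {1..m}" "s ` {1..m} = {Suc (n - m)..n}" "ascents_lr_max m s"
    "tight m Q s" "\<And>c. c \<in> {1..Suc m} \<Longrightarrow> emit (n - m) Q s c = u c"
    using tight_row_exists[of u m n] Suc.prems by (metis Suc_le_eq)
  obtain R where R: "\<And>k. k < m \<Longrightarrow> R k \<subseteq> {1..k} \<and> tight k (R k) (state n R k)"
    "\<And>c. c \<in> {1..m} \<Longrightarrow> state n R m c = s c"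
    using Suc.IH[OF Q(2) _ Q(3)] Suc.prems(2) Suc_leD by blast
  define R' where "R' = R(m := Q)"
  have st: "state n R' k = state n R k" if "k \<le> m" for k
    using that by (intro state_cong) (auto simp: R'_def)
  have "tight m Q (state n R m)" using Q(4) tight_cong[of m "state n R m" s] R(2) by blast
  moreover have "R' m = Q" "\<And>k. k < m \<Longrightarrow> R' k = R k" by (auto simp: R'_def)
  ultimately have "\<forall>k<Suc m. R' k \<subseteq> {1..k} \<and> tight k (R' k) (state n R' k)"
    using R(1) Q(1) by (simp add: less_Suc_eq st)
  moreover have "state n R' (Suc m) c = u c" if "c \<in> {1..Suc m}" for c
  proof -
    have "Suc m \<notin> Q" using Q(1) by auto
    then have "emit (n - m) Q (state n R m) c = emit (n - m) Q s c"
      using emit_cong[of m "state n R m" s Q c "n - m", OF R(2)] that by blast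
    then show ?thesis using Q(5)[OF that] by (simp add: st) (simp add: R'_def)
  qed
  ultimately show ?case by blast
qed simp

section \<open>Tracing without the set of crossed pairs\<close>

text \<open>The pipes leaving a tile to the right and at the top, by the rule that the larger pipe of a cross
  leaves at the top.\<close>

fun route :: "tile \<Rightarrow> nat option \<Rightarrow> nat option \<Rightarrow> nat option \<times> nat option" where
  "route Blank l b = (None, None)"
| "route HTile l b = (l, None)"
| "route JTile l b = (None, l)"
| "route RTile l b = (b, None)"
| "route Bump l b = (b, l)"
| "route Cross l b =
     (case (l, b) of (Some p, Some q) \<Rightarrow> (Some (min p q), Some (max p q)) | _ \<Rightarrow> (l, b))"

primrec right_edge :: "filling \<Rightarrow> nat \<Rightarrow> (nat \<Rightarrow> nat option) \<Rightarrow> nat \<Rightarrow> nat option" where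
  "right_edge T i v 0 = (if meets_left (T (i, 1)) then Some i else None)"
| "right_edge T i v (Suc j) = fst (route (T (i, Suc j)) (right_edge T i v j) (v (Suc j)))"

definition top_edge :: "filling \<Rightarrow> nat \<Rightarrow> (nat \<Rightarrow> nat option) \<Rightarrow> nat \<Rightarrow> nat option" where
  "top_edge T i v j = snd (route (T (i, j)) (right_edge T i v (j - 1)) (v j))"

primrec route_state :: "nat \<Rightarrow> nat \<Rightarrow> filling \<Rightarrow> nat \<Rightarrow> nat \<Rightarrow> nat option" where
  "route_state n b T 0 = (\<lambda>_. None)"
| "route_state n b T (Suc k) =
     (\<lambda>c. if c \<in> {1..b} then top_edge T (n - k) (route_state n b T k) c else None)"

definition fits :: "tile \<Rightarrow> nat option \<Rightarrow> nat option \<Rightarrow> bool" where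
  "fits t l b \<longleftrightarrow> (l \<noteq> None) = meets_left t \<and> (b \<noteq> None) = meets_bottom t"

lemma route_fits:
  assumes "fits t l b"
  shows "(fst (route t l b) \<noteq> None) = meets_right t" "(snd (route t l b) \<noteq> None) = meets_top t"
  using assms
  by (cases t; auto simp: fits_def meets_left_def meets_bottom_def meets_right_def meets_top_def)+

text \<open>\<open>L\<close> lists the pipes along a path from left to right. A new pipe is smaller than the pipes
  present and enters on their left, so that inversions arise only by crossing. The bound \<open>i\<close>
  ensures that a pipe entering later has crossed nothing.\<close>

definition inversions_crossed :: "nat \<Rightarrow> (nat \<Rightarrow> nat option) \<Rightarrow> nat set set \<Rightarrow> bool" where
  "inversions_crossed i L X \<longleftrightarrow>
     (\<forall>c d p q. c < d \<and> L c = Some p \<and> L d = Some q \<longrightarrow> p \<noteq> q \<and> ({p, q} \<in> X \<longleftrightarrow> q < p)) \<and>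
     (\<forall>c p. L c = Some p \<longrightarrow> i \<le> p) \<and> (\<forall>e\<in>X. \<forall>x\<in>e. i \<le> x)"

lemma inversions_crossedD:
  assumes "inversions_crossed i L X" "c < d" "L c = Some p" "L d = Some q"
  shows "p \<noteq> q" "{p, q} \<in> X \<longleftrightarrow> q < p"
  using assms unfolding inversions_crossed_def by blast+

text \<open>Covers an H-tile, where the right one of the two swapped places is empty, and a first crossing, where
  the swapped pair becomes an inversion and is recorded.\<close>

lemma inversions_crossed_swap:
  assumes I: "inversions_crossed i L X"
    and X: "X' = X \<or> (X' = insert {p, q} X \<and> L j = Some p \<and> L (Suc j) = Some q)"
    and new: "\<And>p q. L j = Some p \<Longrightarrow> L (Suc j) = Some q \<Longrightarrow> p < q \<and> {p, q} \<in> X'"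
  shows "inversions_crossed i (L(j := L (Suc j), Suc j := L j)) X'"
proof -
  let ?L = "L(j := L (Suc j), Suc j := L j)"
  define \<pi> where "\<pi> c = (if c = j then Suc j else if c = Suc j then j else c)" for c
  have L: "?L c = L (\<pi> c)" for c by (auto simp: \<pi>_def)
  have "a \<noteq> b \<and> ({a, b} \<in> X' \<longleftrightarrow> b < a)"
    if "c < d" "?L c = Some a" "?L d = Some b" for a b c d
  proof (cases "c = j \<and> d = Suc j")
    case True
    then show ?thesis using that new[of b a] by (auto simp: insert_commute)
  next
    case False
    then have cd: "\<pi> c < \<pi> d" using that(1) by (auto simp: \<pi>_def)
    have ab: "L (\<pi> c) = Some a" "L (\<pi> d) = Some b" using that L by auto
    have "{a, b} \<noteq> {p, q}" if e: "L j = Some p" "L (Suc j) = Some q"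
    proof
      have uniq: "x = y" if "L x = Some z" "L y = Some z" for x y z
        using inversions_crossedD(1)[OF I, of x y] inversions_crossedD(1)[OF I, of y x] that
        by (metis linorder_neqE_nat)
      assume "{a, b} = {p, q}"
      then consider "a = p" "b = q" | "a = q" "b = p" by (auto simp: doubleton_eq_iff)
      then have "(\<pi> c = j \<and> \<pi> d = Suc j) \<or> (\<pi> c = Suc j \<and> \<pi> d = j)"
        using uniq ab e by cases metis+
      then show False using False cd \<open>c < d\<close> by (auto simp: \<pi>_def split: if_splits)
    qed
    then have "{a, b} \<in> X' \<longleftrightarrow> {a, b} \<in> X" using X by auto
    then show ?thesis using inversions_crossedD[OF I cd ab] by simp
  qed
  moreover have "i \<le> p" if "?L c = Some p" for c p
    using that I unfolding L inversions_crossed_def by blast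
  moreover have "\<forall>e\<in>X'. \<forall>x\<in>e. i \<le> x"
    using X I unfolding inversions_crossed_def by auto
  ultimately show ?thesis unfolding inversions_crossed_def by blast
qed

lemma trace_tile_route:
  assumes I: "inversions_crossed i L X" and f: "fits t (L j) (L (Suc j))"
  obtains X' where "trace_tile t (L j) (L (Suc j)) X =
      (fst (route t (L j) (L (Suc j))), snd (route t (L j) (L (Suc j))), X')"
    "inversions_crossed i (L(j := snd (route t (L j) (L (Suc j))),
        Suc j := fst (route t (L j) (L (Suc j))))) X'"
proof (cases t)
  case HTile
  have e: "L (Suc j) = None"
    using f by (auto simp: fits_def HTile meets_bottom_def)
  have "inversions_crossed i (L(j := L (Suc j), Suc j := L j)) X"
    by (rule inversions_crossed_swap[OF I]) (auto simp: e)
  then show ?thesis using that by (simp add: HTile e)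
next
  case Cross
  then obtain p q where pq: "L j = Some p" "L (Suc j) = Some q"
    using f by (auto simp: fits_def meets_left_def meets_bottom_def)
  note d = inversions_crossedD[OF I _ pq, simplified]
  show ?thesis
  proof (cases "{p, q} \<in> X")
    case True
    have "L(j := Some p, Suc j := Some q) = L" using pq by auto
    then show ?thesis using that[of X] True d I by (simp add: Cross pq min_def max_def)
  next
    case False
    then have "p < q" using d by auto
    then have "inversions_crossed i (L(j := L (Suc j), Suc j := L j)) (insert {p, q} X)"
      by (intro inversions_crossed_swap[where p = p and q = q, OF I]) (auto simp: pq)
    then show ?thesis using that[of "insert {p, q} X"] False d
      by (simp add: Cross pq min_def max_def)
  qed
next
  case Blank
  have "L(j := None, Suc j := None) = L"
    using f by (auto simp: fits_def Blank meets_bottom_def meets_left_def)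
  then show ?thesis using that I by (simp add: Blank)
next
  case JTile
  have "L(j := L j, Suc j := None) = L"
    using f by (auto simp: fits_def JTile meets_bottom_def)
  then show ?thesis using that I by (simp add: JTile)
next
  case RTile
  have "L(j := None, Suc j := L (Suc j)) = L"
    using f by (auto simp: fits_def RTile meets_left_def)
  then show ?thesis using that I by (simp add: RTile)
next
  case Bump
  show ?thesis using that I by (simp add: Bump)
qed

text \<open>The path along which pipes are currently cut: top edges of the finished cells, the vertical edge
  before cell \<open>j\<close>, bottom edges of the remaining cells.\<close>

definition front :: "nat \<Rightarrow> (nat \<Rightarrow> nat option) \<Rightarrow> nat option \<Rightarrow> nat \<Rightarrow> nat option" where
  "front j v h c = (if c < j then v c else if c = j then h else v (c - 1))"

lemma trace_row_route:
  assumes I: "inversions_crossed (Suc i) v X" and v0: "v 0 = None"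
    and rl: "\<And>j. j \<in> {1..<b} \<Longrightarrow> meets_right (T (i, j)) = meets_left (T (i, Suc j))"
    and bot: "\<And>j. j \<in> {1..b} \<Longrightarrow> (v j \<noteq> None) = meets_bottom (T (i, j))"
  obtains X' where "trace_row b T i (v, X) =
      (\<lambda>c. if c \<in> {1..b} then top_edge T i v c else v c, X')"
    "inversions_crossed i (\<lambda>c. if c \<in> {1..b} then top_edge T i v c else v c) X'"
    "\<And>j. j \<in> {1..b} \<Longrightarrow> fits (T (i, j)) (right_edge T i v (j - 1)) (v j)"
proof -
  let ?v = "\<lambda>j c. if c \<in> {1..j} then top_edge T i v c else v c"
  let ?h = "right_edge T i v"
  have fit: "fits (T (i, Suc j)) (?h j) (v (Suc j))" if "Suc j \<le> b" for j
    using that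
  proof (induction j)
    case 0
    then show ?case using bot[of 1] by (auto simp: fits_def)
  next
    case (Suc j)
    have "(?h (Suc j) \<noteq> None) = meets_right (T (i, Suc j))"
      using route_fits(1)[of "T (i, Suc j)" "?h j" "v (Suc j)"] Suc by simp
    then show ?case using rl[of "Suc j"] bot[of "Suc (Suc j)"] Suc.prems by (simp add: fits_def)
  qed
  have "\<exists>X'. fold (trace_cell T i) [1..<Suc j] (v, ?h 0, X) = (?v j, ?h j, X') \<and>
      inversions_crossed i (front (Suc j) (?v j) (?h j)) X'" if "j \<le> b" for j
    using that
  proof (induction j)
    case 0
    have h0: "?h 0 = None \<or> ?h 0 = Some i" by simp
    have pipes: "Suc i \<le> p" if "v c = Some p" for c p
      using I that unfolding inversions_crossed_def by blast
    have old: "{i, p} \<notin> X" for p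
      using I unfolding inversions_crossed_def by (meson insertI1 not_less_eq_eq order_refl)
    have "inversions_crossed i (front 1 v (?h 0)) X"
      unfolding inversions_crossed_def
    proof (intro conjI allI impI)
      fix c d p q assume a: "c < d \<and> front 1 v (?h 0) c = Some p \<and> front 1 v (?h 0) d = Some q"
      then have "c \<noteq> 0" using v0 by (cases "c = 0") (auto simp: front_def)
      have dq: "v (d - 1) = Some q" using a \<open>c \<noteq> 0\<close> by (auto simp: front_def split: if_splits)
      show "p \<noteq> q" "({p, q} \<in> X) = (q < p)"
      proof -
        have "p \<noteq> q \<and> (({p, q} \<in> X) = (q < p))"
        proof (cases "c = 1")
          case True
          then have "p = i" using a h0 by (auto simp: front_def)
          then show ?thesis using pipes[OF dq] old by auto
        next
          case False
          then have "v (c - 1) = Some p" "c - 1 < d - 1"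
            using a \<open>c \<noteq> 0\<close> by (auto simp: front_def)
          then show ?thesis using inversions_crossedD[OF I _ _ dq] by blast
        qed
        then show "p \<noteq> q" "({p, q} \<in> X) = (q < p)" by auto
      qed
    next
      fix c p assume "front 1 v (?h 0) c = Some p"
      then have "p = i \<or> v c = Some p \<or> v (c - 1) = Some p"
        by (auto simp: front_def split: if_splits)
      then show "i \<le> p" using pipes[of c p] pipes[of "c - 1" p] by auto
    next
      show "\<forall>e\<in>X. \<forall>x\<in>e. i \<le> x"
        using I unfolding inversions_crossed_def by (meson Suc_leD)
    qed
    moreover have "?v 0 = v" by auto
    ultimately show ?case by simp
  next
    case (Suc j)
    from Suc.IH[OF Suc_leD[OF Suc.prems]] obtain X1 where
      X1: "fold (trace_cell T i) [1..<Suc j] (v, ?h 0, X) = (?v j, ?h j, X1)"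
      "inversions_crossed i (front (Suc j) (?v j) (?h j)) X1"
      by (elim exE conjE)
    define L where "L = front (Suc j) (?v j) (?h j)"
    have L: "L (Suc j) = ?h j" "L (Suc (Suc j)) = v (Suc j)"
      by (auto simp: L_def front_def)
    have f: "fits (T (i, Suc j)) (L (Suc j)) (L (Suc (Suc j)))"
      unfolding L using fit[OF Suc.prems] .
    obtain X' where X': "trace_tile (T (i, Suc j)) (L (Suc j)) (L (Suc (Suc j))) X1 =
      (fst (route (T (i, Suc j)) (L (Suc j)) (L (Suc (Suc j)))),
       snd (route (T (i, Suc j)) (L (Suc j)) (L (Suc (Suc j)))), X')"
      "inversions_crossed i (L(Suc j := snd (route (T (i, Suc j)) (L (Suc j)) (L (Suc (Suc j)))),
        Suc (Suc j) := fst (route (T (i, Suc j)) (L (Suc j)) (L (Suc (Suc j)))))) X'"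
      by (rule trace_tile_route[OF X1(2)[folded L_def] f])
    have vs: "?v (Suc j) = (?v j)(Suc j := top_edge T i v (Suc j))"
      by (auto simp: fun_eq_iff le_Suc_eq)
    have "L(Suc j := top_edge T i v (Suc j), Suc (Suc j) := ?h (Suc j)) =
        front (Suc (Suc j)) (?v (Suc j)) (?h (Suc j))"
      unfolding vs L_def by (auto simp: front_def fun_eq_iff)
    then have "inversions_crossed i (front (Suc (Suc j)) (?v (Suc j)) (?h (Suc j))) X'"
      using X'(2) unfolding L by (simp add: top_edge_def)
    moreover have "fold (trace_cell T i) [1..<Suc (Suc j)] (v, ?h 0, X) = (?v (Suc j), ?h (Suc j), X')"
    proof -
      have "[1..<Suc (Suc j)] = [1..<Suc j] @ [Suc j]" by simp
      then have "fold (trace_cell T i) [1..<Suc (Suc j)] (v, ?h 0, X) =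
          trace_cell T i (Suc j) (?v j, ?h j, X1)" using X1(1) by simp
      also have "\<dots> = (?v (Suc j), ?h (Suc j), X')"
        using X'(1) unfolding vs L by (simp add: trace_cell_def top_edge_def)
      finally show ?thesis .
    qed
    ultimately show ?case by (intro exI conjI)
  qed
  from this[OF order_refl] obtain X' where
    X': "fold (trace_cell T i) [1..<Suc b] (v, ?h 0, X) = (?v b, ?h b, X')"
      "inversions_crossed i (front (Suc b) (?v b) (?h b)) X'" by (elim exE conjE)
  define F where "F = front (Suc b) (?v b) (?h b)"
  note I' = X'(2)[folded F_def]
  have sub: "?v b c = F (if c \<le> b then c else Suc c)" for c
    by (auto simp: F_def front_def)
  have new: "inversions_crossed i (?v b) X'"
    unfolding inversions_crossed_def
  proof (intro conjI allI impI)
    fix c d p q assume a: "c < d \<and> ?v b c = Some p \<and> ?v b d = Some q"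
    have "(if c \<le> b then c else Suc c) < (if d \<le> b then d else Suc d)" using a by auto
    from inversions_crossedD[OF I' this] a[unfolded sub]
    show "p \<noteq> q" "({p, q} \<in> X') = (q < p)" by auto
  next
    fix c p assume "?v b c = Some p"
    then show "i \<le> p" using I' unfolding sub inversions_crossed_def by blast
  next
    show "\<forall>e\<in>X'. \<forall>x\<in>e. i \<le> x" using I' unfolding inversions_crossed_def by blast
  qed
  have tr: "trace_row b T i (v, X) = (?v b, X')"
    using X'(1) by (simp add: trace_row_def)
  show thesis
  proof (rule that[OF tr new])
    fix j assume "j \<in> {1..b}"
    then show "fits (T (i, j)) (right_edge T i v (j - 1)) (v j)" using fit[of "j - 1"] by auto
  qed
qed

lemma route_state_row:
  assumes t: "tiling n b T" and k: "k < n"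
    and I: "inversions_crossed (Suc (n - k)) (route_state n b T k) X"
    and bot: "\<And>j. j \<in> {1..b} \<Longrightarrow> (route_state n b T k j \<noteq> None) = meets_bottom (T (n - k, j))"
  obtains X' where "trace_row b T (n - k) (route_state n b T k, X) = (route_state n b T (Suc k), X')"
    "inversions_crossed (n - k) (route_state n b T (Suc k)) X'"
    "\<And>j. j \<in> {1..b} \<Longrightarrow>
      fits (T (n - k, j)) (right_edge T (n - k) (route_state n b T k) (j - 1)) (route_state n b T k j)"
proof -
  have none: "route_state n b T k c = None" if "c \<notin> {1..b}" for c
    using that by (cases k) auto
  have eq: "(\<lambda>c. if c \<in> {1..b} then top_edge T (n - k) (route_state n b T k) c
      else route_state n b T k c) = route_state n b T (Suc k)"
    using none by (auto simp: fun_eq_iff)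
  have rl: "meets_right (T (n - k, j)) = meets_left (T (n - k, Suc j))" if "j \<in> {1..<b}" for j
    using t that \<open>k < n\<close> by (auto simp: tiling_def)
  have v0: "route_state n b T k 0 = None" using none by simp
  show thesis
    using trace_row_route[where T = T and b = b, OF I v0 rl bot, unfolded eq] that by blast
qed

text \<open>The tiles match along horizontal edges, so the pipes at the top of one row sit exactly where the row above
  it has strands on its bottom edges.\<close>

lemma tracing_state:
  assumes t: "tiling n b T" and "k \<le> n"
  shows "(\<exists>X. fold (trace_row b T) (map (\<lambda>k. n - k) [0..<k]) (\<lambda>_. None, {}) = (route_state n b T k, X) \<and>
      inversions_crossed (Suc (n - k)) (route_state n b T k) X) \<and>
    (k < n \<longrightarrow> (\<forall>j\<in>{1..b}. (route_state n b T k j \<noteq> None) = meets_bottom (T (n - k, j))))"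
  using assms(2)
proof (induction k)
  case 0
  have "inversions_crossed (Suc (n - 0)) (route_state n b T 0) {}"
    by (simp add: inversions_crossed_def)
  moreover have "(route_state n b T 0 j \<noteq> None) = meets_bottom (T (n - 0, j))"
    if "j \<in> {1..b}" "0 < n" for j
    using t that by (auto simp: tiling_def)
  ultimately show ?case by auto
next
  case (Suc k)
  then have "k < n" by simp
  obtain X where X: "fold (trace_row b T) (map (\<lambda>k. n - k) [0..<k]) (\<lambda>_. None, {}) =
      (route_state n b T k, X)" "inversions_crossed (Suc (n - k)) (route_state n b T k) X"
    and b: "\<And>j. j \<in> {1..b} \<Longrightarrow> (route_state n b T k j \<noteq> None) = meets_bottom (T (n - k, j))"
    using Suc.IH \<open>k < n\<close> by (meson less_imp_le)
  obtain X' where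
    X': "trace_row b T (n - k) (route_state n b T k, X) = (route_state n b T (Suc k), X')"
    "inversions_crossed (n - k) (route_state n b T (Suc k)) X'"
    "\<And>j. j \<in> {1..b} \<Longrightarrow>
      fits (T (n - k, j)) (right_edge T (n - k) (route_state n b T k) (j - 1)) (route_state n b T k j)"
    using route_state_row[OF t \<open>k < n\<close> X(2) b] by blast
  have "inversions_crossed (Suc (n - Suc k)) (route_state n b T (Suc k)) X'"
    using X'(2) \<open>k < n\<close> by (metis Suc_diff_Suc)
  moreover have "(route_state n b T (Suc k) j \<noteq> None) = meets_bottom (T (n - Suc k, j))"
    if "j \<in> {1..b}" "Suc k < n" for j
  proof -
    have "(top_edge T (n - k) (route_state n b T k) j \<noteq> None) = meets_top (T (n - k, j))"
      using route_fits(2)[OF X'(3)[OF that(1)]] by (simp add: top_edge_def)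
    moreover have "meets_bottom (T (n - Suc k, j)) = meets_top (T (n - Suc k + 1, j))"
      using t that by (auto simp: tiling_def)
    moreover have "n - Suc k + 1 = n - k" using that by auto
    ultimately show ?thesis using that by simp
  qed
  moreover have "fold (trace_row b T) (map (\<lambda>k. n - k) [0..<Suc k]) (\<lambda>_. None, {}) =
      (route_state n b T (Suc k), X')"
    unfolding upt_Suc_append[OF le0] map_append fold_append comp_def X(1)
    by (simp only: list.map fold_simps X'(1))
  ultimately show ?case by blast
qed

lemma exit_pipe_route:
  assumes "tiling n b T"
  shows "exit_pipe n b T = route_state n b T n"
proof -
  have "rev [1..<n + 1] = map (\<lambda>k. n - k) [0..<n]"
    by (rule nth_equalityI) (auto simp: rev_nth simp del: upt_Suc)
  then show ?thesis using tracing_state[OF assms, of n] by (auto simp: exit_pipe_def)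
qed

lemma route_state_fits:
  assumes t: "tiling n b T" "k < n" "j \<in> {1..b}"
  shows "(route_state n b T k j \<noteq> None) = meets_bottom (T (n - k, j))"
    and "fits (T (n - k, j)) (right_edge T (n - k) (route_state n b T k) (j - 1)) (route_state n b T k j)"
proof -
  obtain X where X: "inversions_crossed (Suc (n - k)) (route_state n b T k) X"
    and b: "\<And>j. j \<in> {1..b} \<Longrightarrow> (route_state n b T k j \<noteq> None) = meets_bottom (T (n - k, j))"
    using tracing_state[OF t(1), of k] t(2) by (meson less_imp_le)
  show "(route_state n b T k j \<noteq> None) = meets_bottom (T (n - k, j))" using b[OF t(3)] .
  show "fits (T (n - k, j)) (right_edge T (n - k) (route_state n b T k) (j - 1)) (route_state n b T k j)"
    using route_state_row[OF t(1,2) X b] t(3) by blast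
qed

lemma tiling_outside: "tiling a b T \<Longrightarrow> x \<notin> grid a b \<Longrightarrow> T x = Blank"
  unfolding tiling_def by blast

section \<open>Pipe dreams and sets of crosses\<close>

definition staircase :: "nat \<Rightarrow> (nat \<times> nat) set" where
  "staircase n = {(i, j). 1 \<le> i \<and> 1 \<le> j \<and> i + j \<le> n}"

definition dream_of :: "nat \<Rightarrow> (nat \<times> nat) set \<Rightarrow> filling" where
  "dream_of n D = (\<lambda>(i, j).
     if (i, j) \<in> staircase n then (if (i, j) \<in> D then Cross else Bump)
     else if 1 \<le> i \<and> 1 \<le> j \<and> i + j = n + 1 then JTile else Blank)"

lemma row_cells_staircase: "D \<subseteq> staircase n \<Longrightarrow> k < n \<Longrightarrow> row_cells n D k \<subseteq> {1..k}"
  by (auto simp: row_cells_def staircase_def)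

lemma pipe_dream_dream_of: "pipe_dream n (dream_of n D)"
  unfolding pipe_dream_def tiling_def
  by (auto simp: dream_of_def grid_def staircase_def meets_left_def meets_right_def
      meets_top_def meets_bottom_def)

lemma wty_PD_dream_of: "D \<subseteq> staircase n \<Longrightarrow> wty_PD n (dream_of n D) = D"
  by (auto simp: wty_PD_def dream_of_def grid_def staircase_def split: if_splits)

text \<open>Row by row from the top: strands on the top edges occupy an initial segment of the columns. A J-tile
  stops the horizontal strand, so the next tile is blank and has no top strand; hence the J-tile
  can only be at the end of the segment, and the segment below it is shorter by one.\<close>

lemma pipe_dream_row_shape:
  assumes P: "pipe_dream n P" and "Suc i \<le> n"
  shows "\<forall>j\<in>{1..n}. meets_top (P (Suc i, j)) \<longleftrightarrow> j \<le> n - i"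
    and "\<forall>j\<in>{1..n}. P (Suc i, j) \<in> (if j < n - i then {Cross, Bump} else if j = n - i then {JTile} else {Blank})"
proof -
  have tiles: "P (a, b) \<in> {Cross, Bump, JTile, Blank}" if "a \<in> {1..n}" "b \<in> {1..n}" for a b
    using P that by (auto simp: pipe_dream_def grid_def)
  have lr: "meets_right (P (a, b)) = meets_left (P (a, Suc b))" if "a \<in> {1..n}" "b \<in> {1..<n}" for a b
    using P that by (auto simp: pipe_dream_def tiling_def)
  have le: "\<not> meets_right (P (a, n))" if "a \<in> {1..n}" for a
    using P that by (auto simp: pipe_dream_def tiling_def)
  have shape: "P (a, j) \<in> (if j < m then {Cross, Bump} else if j = m then {JTile} else {Blank})"
    if a: "a \<in> {1..n}" and m: "m \<in> {1..n}"
      and top: "\<And>j. j \<in> {1..n} \<Longrightarrow> meets_top (P (a, j)) \<longleftrightarrow> j \<le> m" and j: "j \<in> {1..n}" for a m j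
  proof -
    consider "j < m" | "j = m" | "m < j" by linarith
    then show ?thesis
    proof cases
      case 1
      then have "meets_left (P (a, Suc j))"
        using tiles[OF a, of "Suc j"] top[of "Suc j"] m j by (auto simp: meets_top_def meets_left_def)
      then have "meets_right (P (a, j))" using lr[OF a, of j] 1 m j by auto
      then show ?thesis using 1 tiles[OF a j] by (auto simp: meets_right_def)
    next
      case 2
      have "\<not> meets_right (P (a, j))"
      proof (cases "j = n")
        case False
        then have "\<not> meets_left (P (a, Suc j))"
          using tiles[OF a, of "Suc j"] top[of "Suc j"] 2 j by (auto simp: meets_top_def meets_left_def)
        then show ?thesis using lr[OF a, of j] False j by auto
      qed (use le[OF a] in simp)
      moreover have "meets_top (P (a, j))" using top[OF j] 2 by simp
      ultimately show ?thesis using 2 tiles[OF a j] by (auto simp: meets_right_def meets_top_def)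
    next
      case 3
      then show ?thesis using top[OF j] tiles[OF a j] by (auto simp: meets_top_def)
    qed
  qed
  have tops: "\<forall>j\<in>{1..n}. meets_top (P (Suc i, j)) \<longleftrightarrow> j \<le> n - i" if "Suc i \<le> n" for i
    using that
  proof (induction i)
    case 0
    then show ?case using P by (auto simp: pipe_dream_def)
  next
    case (Suc i)
    show ?case
    proof
      fix j assume j: "j \<in> {1..n}"
      have "P (Suc i, j) \<in> (if j < n - i then {Cross, Bump} else if j = n - i then {JTile} else {Blank})"
        using Suc j by (intro shape) auto
      then have "meets_bottom (P (Suc i, j)) \<longleftrightarrow> j < n - i"
        by (auto simp: meets_bottom_def split: if_splits)
      moreover have "meets_bottom (P (Suc i, j)) = meets_top (P (Suc (Suc i), j))"
        using P Suc.prems j by (auto simp: pipe_dream_def tiling_def)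
      ultimately show "meets_top (P (Suc (Suc i), j)) \<longleftrightarrow> j \<le> n - Suc i" using Suc.prems by auto
    qed
  qed
  show "\<forall>j\<in>{1..n}. meets_top (P (Suc i, j)) \<longleftrightarrow> j \<le> n - i" using tops assms(2) by blast
  then show "\<forall>j\<in>{1..n}. P (Suc i, j) \<in> (if j < n - i then {Cross, Bump} else if j = n - i then {JTile} else {Blank})"
    using assms(2) shape[of "Suc i" "n - i"] by auto
qed

lemma pipe_dream_eq_dream_of:
  assumes P: "pipe_dream n P"
  shows "wty_PD n P \<subseteq> staircase n" "P = dream_of n (wty_PD n P)"
proof -
  have row: "P (i, j) \<in> (if i + j \<le> n then {Cross, Bump} else if i + j = n + 1 then {JTile} else {Blank})"
    if "i \<in> {1..n}" "j \<in> {1..n}" for i j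
  proof -
    have P': "P (Suc (i - 1), j) \<in>
        (if j < n - (i - 1) then {Cross, Bump} else if j = n - (i - 1) then {JTile} else {Blank})"
      using that by (intro bspec[OF pipe_dream_row_shape(2)[OF P]]) auto
    have e: "Suc (i - 1) = i" "j < n - (i - 1) \<longleftrightarrow> i + j \<le> n" "j = n - (i - 1) \<longleftrightarrow> i + j = n + 1"
      using that by auto
    show ?thesis using P' unfolding e .
  qed
  show "wty_PD n P \<subseteq> staircase n"
  proof
    fix x assume x: "x \<in> wty_PD n P"
    then obtain i j where "x = (i, j)" "i \<in> {1..n}" "j \<in> {1..n}" "P (i, j) = Cross"
      by (auto simp: wty_PD_def grid_def)
    then show "x \<in> staircase n" using row[of i j] by (auto simp: staircase_def split: if_splits)
  qed
  show "P = dream_of n (wty_PD n P)"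
  proof
    fix x
    show "P x = dream_of n (wty_PD n P) x"
    proof (cases "x \<in> grid n n")
      case True
      then obtain i j where "x = (i, j)" "i \<in> {1..n}" "j \<in> {1..n}"
        by (auto simp: grid_def)
      then show ?thesis using row[of i j]
        by (auto simp: dream_of_def wty_PD_def grid_def staircase_def split: if_splits)
    next
      case False
      obtain i j where x: "x = (i, j)" by (cases x)
      have "P x = Blank" using tiling_outside[of n n P x] P False by (simp add: pipe_dream_def)
      moreover have "dream_of n A x = Blank" for A
        using False by (auto simp: x dream_of_def grid_def staircase_def)
      ultimately show ?thesis by simp
    qed
  qed
qed

lemma route_state_dream_of:
  assumes D: "D \<subseteq> staircase n" and "k \<le> n"
  shows "route_state n n (dream_of n D) k c =
    (if c \<in> {1..k} then Some (state n (row_cells n D) k c) else None)"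
  using assms(2)
proof (induction k arbitrary: c)
  case (Suc k)
  let ?T = "dream_of n D" and ?v = "route_state n n (dream_of n D) k"
  let ?R = "row_cells n D k" and ?s = "state n (row_cells n D) k" and ?i = "n - k"
  have R: "?R \<subseteq> {1..k}" using row_cells_staircase[OF D] Suc.prems by auto
  have v: "?v c = (if c \<in> {1..k} then Some (?s c) else None)" for c using Suc by auto
  have T: "?T (?i, Suc j) = (if Suc j \<le> k then if Suc j \<in> ?R then Cross else Bump
      else if j = k then JTile else Blank)" for j
    using Suc.prems by (auto simp: dream_of_def staircase_def row_cells_def)
  have re: "right_edge ?T ?i ?v j = (if j \<le> k then Some (carry ?i ?R ?s j) else None)" for j
  proof (induction j)
    case 0
    then show ?case using T[of 0] by (auto simp: meets_left_def)
  next
    case (Suc j)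
    then show ?case by (auto simp: T v)
  qed
  have te: "top_edge ?T ?i ?v (Suc j) = (if j \<le> k then Some (emit ?i ?R ?s (Suc j)) else None)" for j
    using R by (auto simp: top_edge_def T v re emit_def)
  show ?case
    using te[of "c - 1"] Suc.prems by (cases c) auto
qed simp

lemma dream_of_in_PD:
  assumes "D \<subseteq> staircase n"
  shows "dream_of n D \<in> PD n w \<longleftrightarrow> (\<forall>c\<in>{1..n}. state n (row_cells n D) n c = inv w c)"
proof -
  have "tiling n n (dream_of n D)" using pipe_dream_dream_of[of n D] by (simp add: pipe_dream_def)
  then show ?thesis
    using route_state_dream_of[OF assms order_refl] pipe_dream_dream_of[of n D]
    by (simp add: PD_def exit_pipe_route)
qed

section \<open>Bumpless vertical-less pipe dreams and tight sets of cells\<close>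

text \<open>What a bumpless tiling sees of a word \<open>s\<close> of length \<open>k\<close>.\<close>

definition descent_bottom :: "nat \<Rightarrow> (nat \<Rightarrow> nat) \<Rightarrow> nat \<Rightarrow> nat option" where
  "descent_bottom k s c = (if 1 \<le> c \<and> c < k \<and> s (Suc c) < s c then Some (s (Suc c)) else None)"

context row begin

text \<open>The pipe entering a weighty cell \<open>j\<close> of the bumpless row from the left is the pipe that \<^emph>\<open>leaves\<close> cell \<open>j\<close>
  of the pipe dream to the right: the bumpless row runs one column ahead, just as the descent bottom
  \<open>s\<^sub>j\<^sub>+\<^sub>1\<close> is placed in column \<open>j\<close>. With this shift each of the five tiles acts on descent bottoms
  as the corresponding pair of neighbouring cells acts on the word.\<close>

lemma route_descent_bottom:
  assumes fw: "ascents_lr_max k s" and t: "tight k R s" and "1 \<le> j" and "T \<noteq> Bump"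
    and T: "meets_left T = (j \<in> R)" "meets_right T = (Suc j \<in> R)"
      "meets_bottom T = (descent_bottom k s j \<noteq> None)"
  shows "route T (if j \<in> R then Some (h j) else None) (descent_bottom k s j) =
    (if Suc j \<in> R then Some (h (Suc j)) else None, descent_bottom (Suc k) out j)"
proof -
  have bump_top: "descent_bottom (Suc k) out j = None" if "j \<notin> R"
  proof (cases "j \<le> k")
    case True
    then have "carry_max j" using tight_carry_max[OF t] that \<open>1 \<le> j\<close> by auto
    then have "out j < h j" using \<open>1 \<le> j\<close> by (auto simp: carry_max_def)
    then show ?thesis by (auto simp: descent_bottom_def emit_def[of i R s "Suc j"])
  qed (simp add: descent_bottom_def)
  have carry_le: "h j \<le> s j" if "j \<in> R" using that \<open>1 \<le> j\<close> by (cases j) auto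
  have emit_ge: "s j \<le> out j" if "j \<in> R" using that by (simp add: emit_def)
  have k: "j \<in> R \<Longrightarrow> j \<le> k" using cells by auto
  show ?thesis
  proof (cases T)
    case Blank
    then have "j \<notin> R" "Suc j \<notin> R" using T by (auto simp: meets_left_def meets_right_def)
    then show ?thesis using bump_top by (simp add: Blank)
  next
    case HTile
    then have r: "j \<in> R" "Suc j \<in> R" "descent_bottom k s j = None"
      using T by (auto simp: meets_left_def meets_right_def meets_bottom_def)
    then have jk: "j < k" using cells by auto
    have "\<not> s (Suc j) < s j" using r(3) jk \<open>1 \<le> j\<close> by (simp add: descent_bottom_def split: if_splits)
    moreover have "s (Suc j) \<noteq> s j" using inj_onD[OF inj, of "Suc j" j] jk \<open>1 \<le> j\<close> by auto
    ultimately have asc: "s j < s (Suc j)" by simp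
    then have "lr_max s (Suc j)" using fw jk \<open>1 \<le> j\<close> by (auto simp: ascents_lr_max_def)
    then have "out j < s (Suc j)" using lr_max_iff[OF jk] \<open>1 \<le> j\<close> by auto
    then have "descent_bottom (Suc k) out j = None"
      using r by (auto simp: descent_bottom_def emit_def[of i R s "Suc j"])
    moreover have "h (Suc j) = h j" using r carry_le asc by simp
    ultimately show ?thesis using r by (simp add: HTile)
  next
    case JTile
    then have r: "j \<in> R" "Suc j \<notin> R"
      using T by (auto simp: meets_left_def meets_right_def)
    then have "descent_bottom (Suc k) out j = Some (h j)"
      using carry_less_emit[OF r(1)] k \<open>1 \<le> j\<close>
      by (auto simp: descent_bottom_def emit_def[of i R s "Suc j"])
    then show ?thesis using r by (simp add: JTile)
  next
    case RTile
    then have r: "j \<notin> R" "Suc j \<in> R" "descent_bottom k s j \<noteq> None"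
      using T by (auto simp: meets_left_def meets_right_def meets_bottom_def)
    then have "s (Suc j) < s j" "descent_bottom k s j = Some (s (Suc j))"
      by (auto simp: descent_bottom_def split: if_splits)
    moreover have "h j = s j" using r \<open>1 \<le> j\<close> by (cases j) auto
    ultimately have "descent_bottom k s j = Some (h (Suc j))"
      using r by simp
    then show ?thesis using r bump_top by (simp add: RTile)
  next
    case Cross
    then have r: "j \<in> R" "Suc j \<in> R" "descent_bottom k s j \<noteq> None"
      using T by (auto simp: meets_left_def meets_right_def meets_bottom_def)
    then have d: "s (Suc j) < s j" "j < k" by (auto simp: descent_bottom_def split: if_splits)
    have "out (Suc j) = max (h j) (s (Suc j))" using r by (simp add: emit_def)
    moreover from this have "out (Suc j) < out j"
      using d emit_ge[OF r(1)] carry_less_emit[OF r(1)] by simp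
    ultimately show ?thesis using r d \<open>1 \<le> j\<close> by (simp add: Cross descent_bottom_def)
  qed (use assms in simp)
qed

text \<open>For fireworks words an entry after the first is a left-to-right maximum iff it is not a descent
  bottom. Then tightness says which triples of left, right and bottom strands occur, and these are
  the triples realised by the bumpless tiles.\<close>

lemma tight_iff_descent_bottom:
  assumes fw: "ascents_lr_max k s"
  shows "tight k R s \<longleftrightarrow> (\<forall>j\<ge>1. (descent_bottom k s j \<noteq> None \<longrightarrow> Suc j \<in> R) \<and>
    (Suc j \<in> R \<and> j \<notin> R \<longrightarrow> descent_bottom k s j \<noteq> None))"
proof -
  have lr: "lr_max s (Suc j) \<longleftrightarrow> descent_bottom k s j = None" if "1 \<le> j" "Suc j \<le> k" for j
  proof
    assume "lr_max s (Suc j)"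
    then have "s j < s (Suc j)" using that by (auto simp: lr_max_def)
    then show "descent_bottom k s j = None" by (simp add: descent_bottom_def)
  next
    assume "descent_bottom k s j = None"
    then have "\<not> s (Suc j) < s j" using that by (simp add: descent_bottom_def split: if_splits)
    moreover have "s (Suc j) \<noteq> s j" using inj_onD[OF inj, of "Suc j" j] that by auto
    ultimately show "lr_max s (Suc j)" using fw that by (auto simp: ascents_lr_max_def)
  qed
  have lr1: "lr_max s 1" by (simp add: lr_max_def)
  have some: "j < k" if "descent_bottom k s j \<noteq> None" for j
    using that by (auto simp: descent_bottom_def split: if_splits)
  have R: "Suc j \<le> k" if "Suc j \<in> R" for j using that cells by auto
  have "(\<forall>j\<in>{1..k}. j \<notin> R \<longrightarrow> lr_max s j) \<longleftrightarrow> (\<forall>j\<ge>1. descent_bottom k s j \<noteq> None \<longrightarrow> Suc j \<in> R)"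
  proof safe
    fix j y assume a: "\<forall>j\<in>{1..k}. j \<notin> R \<longrightarrow> lr_max s j" "1 \<le> j" "descent_bottom k s j = Some y"
    then have "j < k" using some by auto
    then show "Suc j \<in> R" using a lr[of j] by (metis One_nat_def Suc_le_eq Suc_le_mono atLeastAtMost_iff option.distinct(1) zero_le)
  next
    fix j assume a: "\<forall>j\<ge>1. descent_bottom k s j \<noteq> None \<longrightarrow> Suc j \<in> R" "j \<in> {1..k}" "j \<notin> R"
    show "lr_max s j"
    proof (cases "j = 1")
      case False
      then obtain j' where j': "j = Suc j'" "1 \<le> j'" using a(2) by (cases j) auto
      then show ?thesis using a(1)[rule_format, of j'] a(2,3) lr[of j'] by auto
    qed (use lr1 in simp)
  qed
  moreover have "(\<forall>j\<in>{1..<k}. j \<notin> R \<and> Suc j \<in> R \<longrightarrow> \<not> lr_max s (Suc j)) \<longleftrightarrow>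
      (\<forall>j\<ge>1. Suc j \<in> R \<and> j \<notin> R \<longrightarrow> descent_bottom k s j \<noteq> None)"
    using lr R by (auto simp: Suc_le_eq)
  ultimately show ?thesis unfolding tight_def by blast
qed

end

lemma bvpd_tiles:
  assumes "bvpd n B"
  shows "B x \<noteq> Bump"
proof (cases "x \<in> grid n (n - 1)")
  case True
  then show ?thesis using assms unfolding bvpd_def by fastforce
next
  case False
  then have "B x = Blank" using tiling_outside[of n "n - 1" B x] assms by (simp add: bvpd_def)
  then show ?thesis by simp
qed

lemma wty_BVPD_iff:
  assumes "bvpd n B"
  shows "(i, j) \<in> wty_BVPD n B \<longleftrightarrow> meets_left (B (i, j))"
proof (cases "(i, j) \<in> grid n (n - 1)")
  case True
  then show ?thesis using bvpd_tiles[OF assms, of "(i, j)"] by (auto simp: wty_BVPD_def meets_left_def)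
next
  case False
  then have "B (i, j) = Blank" using assms tiling_outside by (auto simp: bvpd_def)
  then show ?thesis by (simp add: wty_BVPD_def meets_left_def)
qed

lemma bvpd_right:
  assumes "bvpd n B" "i \<in> {1..n}" "j \<in> {1..n - 1}"
  shows "meets_right (B (i, j)) = meets_left (B (i, Suc j))"
proof (cases "j = n - 1")
  case True
  then have "(i, Suc j) \<notin> grid n (n - 1)" by (simp add: grid_def)
  then have "B (i, Suc j) = Blank" using assms(1) tiling_outside by (auto simp: bvpd_def)
  moreover have "\<not> meets_right (B (i, j))" using assms True by (auto simp: bvpd_def tiling_def)
  ultimately show ?thesis by (simp add: meets_left_def)
next
  case False
  then show ?thesis using assms by (auto simp: bvpd_def tiling_def)
qed

text \<open>By descending row by row from the top: a row without top strands beyond column \<open>n - i\<close> can only carry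
  blanks there, because without J- and cross tiles a horizontal strand would run into the right boundary.
  Hence the tile in column \<open>n - i\<close> has no right strand and therefore no bottom strand, and the bound
  drops by one in the next row.\<close>

lemma wty_BVPD_staircase:
  assumes B: "bvpd n B"
  shows "wty_BVPD n B \<subseteq> staircase n"
proof -
  have outside: "B (i, j) = Blank" if "(i, j) \<notin> grid n (n - 1)" for i j
    using B that tiling_outside by (auto simp: bvpd_def)
  have row: "\<not> meets_left (B (i, j)) \<and> \<not> meets_bottom (B (i, j))"
    if i: "i \<in> {1..n}" and top: "\<And>j. j > n - i \<Longrightarrow> \<not> meets_top (B (i, j))" and j: "j > n - i" for i j
  proof -
    have blank: "B (i, j) = Blank" if "j \<le> n" "j > n - i" for j
      using that
    proof (induction j rule: inc_induct)
      case base
      then show ?case using outside[of i n] i by (auto simp: grid_def)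
    next
      case (step j)
      have "\<not> meets_right (B (i, j))"
        using bvpd_right[OF B i, of j] step by (auto simp: meets_left_def)
      moreover have "\<not> meets_top (B (i, j))" using top step by simp
      ultimately show ?case using bvpd_tiles[OF B, of "(i, j)"]
        by (cases "B (i, j)") (auto simp: meets_right_def meets_top_def)
    qed
    moreover have "B (i, j) = Blank" if "\<not> j \<le> n"
      using that by (intro outside) (auto simp: grid_def)
    ultimately have "B (i, j) = Blank" using j by blast
    then show ?thesis by (simp add: meets_left_def meets_bottom_def)
  qed
  have edge: "\<not> meets_bottom (B (i, n - i))"
    if i: "i \<in> {1..n}" and top: "\<And>j. j > n - i \<Longrightarrow> \<not> meets_top (B (i, j))" for i
  proof (cases "n - i \<in> {1..n - 1}")
    case True
    then have "\<not> meets_right (B (i, n - i))"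
      using bvpd_right[OF B i True] row[OF i top, of "Suc (n - i)"] by simp
    then show ?thesis using bvpd_tiles[OF B, of "(i, n - i)"]
      by (cases "B (i, n - i)") (auto simp: meets_right_def meets_bottom_def)
  next
    case False
    then show ?thesis using outside[of i "n - i"] by (auto simp: grid_def meets_bottom_def)
  qed
  have top: "\<not> meets_top (B (Suc i, j))" if "Suc i \<le> n" "j > n - Suc i" for i j
    using that
  proof (induction i arbitrary: j)
    case 0
    then show ?case using outside[of 1 j] by (auto simp: grid_def meets_top_def)
  next
    case (Suc i)
    have t: "\<not> meets_top (B (Suc i, j))" if "j > n - Suc i" for j using Suc.IH that Suc.prems by simp
    have "\<not> meets_bottom (B (Suc i, j))"
    proof (cases "j = n - Suc i")
      case True
      then show ?thesis using edge[of "Suc i"] t Suc.prems by auto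
    next
      case False
      then show ?thesis using row[of "Suc i" j] t Suc.prems by auto
    qed
    then show ?case
    proof (cases "j \<in> {1..n - 1}")
      case True
      then have "meets_bottom (B (Suc i, j)) = meets_top (B (Suc i + 1, j))"
        using B Suc.prems by (auto simp: bvpd_def tiling_def)
      then show ?thesis using \<open>\<not> meets_bottom (B (Suc i, j))\<close> by simp
    next
      case False
      then show ?thesis using outside[of "Suc (Suc i)" j] by (auto simp: grid_def meets_top_def)
    qed
  qed
  show ?thesis
  proof
    fix x assume x: "x \<in> wty_BVPD n B"
    then obtain i j where ij: "x = (i, j)" "i \<in> {1..n}" "1 \<le> j"
      by (auto simp: wty_BVPD_def grid_def)
    then have "meets_left (B (i, j))" using wty_BVPD_iff[OF B] x by simp
    then have "\<not> j > n - i" using row[OF ij(2)] top[of "i - 1"] ij(2) by auto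
    then show "x \<in> staircase n" using ij by (auto simp: staircase_def)
  qed
qed

text \<open>The tightness of a row and the description of its top edges need each other: the strands on the bottom edges
  are known from the rows below, they force tightness, and tightness determines the top edges.\<close>

lemma route_state_bvpd:
  assumes B: "bvpd n B" and k: "k \<le> n"
  defines "R \<equiv> row_cells n (wty_BVPD n B)"
  shows "(\<forall>m<k. tight m (R m) (state n R m)) \<and>
    (\<forall>c. route_state n (n - 1) B k c = descent_bottom k (state n R k) c)"
  using k
proof (induction k)
  case 0
  then show ?case by (auto simp: descent_bottom_def)
next
  case (Suc k)
  let ?i = "n - k" and ?s = "state n R k" and ?v = "route_state n (n - 1) B k"
  have "k < n" using Suc.prems by simp
  have t: "tiling n (n - 1) B" using B by (simp add: bvpd_def)
  have v: "?v c = descent_bottom k ?s c" for c using Suc by auto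
  have R: "\<And>k. k < n \<Longrightarrow> R k \<subseteq> {1..k}"
    unfolding R_def by (rule row_cells_staircase[OF wty_BVPD_staircase[OF B]])
  interpret row ?i k "R k" ?s using R \<open>k < n\<close> by (rule row_state)
  have fw: "ascents_lr_max k ?s"
    using Suc by (intro ascents_lr_max_state R) auto
  have l: "meets_left (B (?i, j)) = (j \<in> R k)" for j
    using wty_BVPD_iff[OF B] by (simp add: R_def row_cells_def)
  have r: "meets_right (B (?i, j)) = (Suc j \<in> R k)" if "j \<in> {1..n - 1}" for j
    using bvpd_right[OF B _ that, of ?i] l[of "Suc j"] \<open>k < n\<close> by auto
  have b: "meets_bottom (B (?i, j)) = (descent_bottom k ?s j \<noteq> None)" if "j \<in> {1..n - 1}" for j
    using route_state_fits(1)[OF t \<open>k < n\<close> that] v by simp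
  have tight: "tight k (R k) ?s"
    unfolding tight_iff_descent_bottom[OF fw]
  proof (intro allI impI)
    fix j :: nat assume "1 \<le> j"
    show "(descent_bottom k ?s j \<noteq> None \<longrightarrow> Suc j \<in> R k) \<and>
      (Suc j \<in> R k \<and> j \<notin> R k \<longrightarrow> descent_bottom k ?s j \<noteq> None)"
    proof (cases "j \<le> n - 1")
      case True
      then have j: "j \<in> {1..n - 1}" using \<open>1 \<le> j\<close> by simp
      show ?thesis unfolding l[of j, symmetric] r[OF j, symmetric] b[OF j, symmetric]
        using bvpd_tiles[OF B, of "(?i, j)"]
        by (cases "B (?i, j)") (auto simp: meets_left_def meets_right_def meets_bottom_def)
    next
      case False
      then have "Suc j \<notin> R k" using cells \<open>k < n\<close> by auto
      moreover have "descent_bottom k ?s j = None" using False \<open>k < n\<close> by (auto simp: descent_bottom_def)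
      ultimately show ?thesis by simp
    qed
  qed
  have step: "route (B (?i, j)) (if j \<in> R k then Some (h j) else None) (?v j) =
      (if Suc j \<in> R k then Some (h (Suc j)) else None, descent_bottom (Suc k) out j)"
    if j: "j \<in> {1..n - 1}" for j
    unfolding v using route_descent_bottom[OF fw tight _ bvpd_tiles[OF B] l r[OF j] b[OF j]] j by simp
  have re: "right_edge B ?i ?v j = (if Suc j \<in> R k then Some (h (Suc j)) else None)" if "j \<le> n - 1" for j
    using that
  proof (induction j)
    case 0
    have "?i < ?s 1" if "1 \<in> R k" using newest[of 1] that cells by auto
    then show ?case using l[of 1] by auto
  next
    case (Suc j)
    then show ?case using step[of "Suc j"] by auto
  qed
  have "route_state n (n - 1) B (Suc k) c = descent_bottom (Suc k) (state n R (Suc k)) c" for c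
  proof (cases "c \<in> {1..n - 1}")
    case True
    then show ?thesis using step[OF True] re[of "c - 1"] by (auto simp: top_edge_def)
  next
    case False
    then show ?thesis using \<open>k < n\<close> by (auto simp: descent_bottom_def)
  qed
  then show ?case using Suc.IH \<open>k < n\<close> tight by (auto simp: less_Suc_eq)
qed

text \<open>A bumpless tile is determined by its left, right and bottom strands.\<close>

definition tile_of :: "bool \<Rightarrow> bool \<Rightarrow> bool \<Rightarrow> tile" where
  "tile_of l r b =
     (if l then (if r then (if b then Cross else HTile) else JTile) else (if r then RTile else Blank))"

definition bvpd_of :: "nat \<Rightarrow> (nat \<times> nat) set \<Rightarrow> filling" where
  "bvpd_of n D = (\<lambda>(i, j). if (i, j) \<in> grid n (n - 1)
     then tile_of ((i, j) \<in> D) ((i, Suc j) \<in> D)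
       (descent_bottom (n - i) (state n (row_cells n D) (n - i)) j \<noteq> None)
     else Blank)"

lemma bvpd_eq_bvpd_of:
  assumes B: "bvpd n B"
  shows "B = bvpd_of n (wty_BVPD n B)"
proof
  fix x :: "nat \<times> nat"
  obtain i j where x: "x = (i, j)" by (cases x)
  show "B x = bvpd_of n (wty_BVPD n B) x"
  proof (cases "x \<in> grid n (n - 1)")
    case True
    then have ij: "i \<in> {1..n}" "j \<in> {1..n - 1}" by (auto simp: x grid_def)
    have "B x = tile_of (meets_left (B x)) (meets_right (B x)) (meets_bottom (B x))"
      using bvpd_tiles[OF B, of x]
      by (cases "B x") (auto simp: tile_of_def meets_left_def meets_right_def meets_bottom_def)
    moreover have "meets_bottom (B (n - (n - i), j)) =
        (descent_bottom (n - i) (state n (row_cells n (wty_BVPD n B)) (n - i)) j \<noteq> None)"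
      using route_state_fits(1)[of n "n - 1" B "n - i" j] route_state_bvpd[OF B, of "n - i"] B ij
      by (auto simp: bvpd_def)
    moreover have "n - (n - i) = i" using ij by auto
    ultimately show ?thesis
      using True wty_BVPD_iff[OF B] bvpd_right[OF B ij] by (simp add: x bvpd_of_def)
  next
    case False
    then have "B x = Blank" using tiling_outside[of n "n - 1" B x] B by (simp add: bvpd_def)
    then show ?thesis using False by (simp add: x bvpd_of_def)
  qed
qed

lemma bvpd_of_bvpd:
  assumes D: "D \<subseteq> staircase n"
    and t: "\<And>k. k < n \<Longrightarrow> tight k (row_cells n D k) (state n (row_cells n D) k)"
  shows "bvpd n (bvpd_of n D)" "wty_BVPD n (bvpd_of n D) = D"
proof -
  let ?B = "bvpd_of n D" and ?R = "row_cells n D"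
  let ?s = "state n ?R"
  have R: "\<And>k. k < n \<Longrightarrow> ?R k \<subseteq> {1..k}" by (rule row_cells_staircase[OF D])
  have edges: "meets_left (?B (n - k, j)) = (j \<in> ?R k) \<and> meets_right (?B (n - k, j)) = (Suc j \<in> ?R k) \<and>
      meets_bottom (?B (n - k, j)) = (descent_bottom k (?s k) j \<noteq> None) \<and>
      meets_top (?B (n - k, j)) = (descent_bottom (Suc k) (?s (Suc k)) j \<noteq> None)"
    if k: "k < n" and j: "j \<in> {1..n - 1}" for k j
  proof -
    interpret row "n - k" k "?R k" "?s k" using R k by (rule row_state)
    have fw: "ascents_lr_max k (?s k)" using k by (intro ascents_lr_max_state R t) auto
    let ?b = "descent_bottom k (?s k) j"
    have "(n - k, j) \<in> grid n (n - 1)" "n - (n - k) = k" using k j by (auto simp: grid_def)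
    then have B: "?B (n - k, j) = tile_of (j \<in> ?R k) (Suc j \<in> ?R k) (?b \<noteq> None)"
      by (simp add: bvpd_of_def row_cells_def)
    have valid: "(?b \<noteq> None \<longrightarrow> Suc j \<in> ?R k) \<and> (Suc j \<in> ?R k \<and> j \<notin> ?R k \<longrightarrow> ?b \<noteq> None)"
      using t[OF k] j unfolding tight_iff_descent_bottom[OF fw] by auto
    have e: "meets_left (?B (n - k, j)) = (j \<in> ?R k)" "meets_right (?B (n - k, j)) = (Suc j \<in> ?R k)"
      "meets_bottom (?B (n - k, j)) = (?b \<noteq> None)"
      using valid unfolding B
      by (auto simp: tile_of_def meets_left_def meets_right_def meets_bottom_def)
    have nb: "?B (n - k, j) \<noteq> Bump" unfolding B by (auto simp: tile_of_def)
    have f: "fits (?B (n - k, j)) (if j \<in> ?R k then Some (h j) else None) ?b"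
      using e by (auto simp: fits_def)
    have "1 \<le> j" using j by simp
    have "meets_top (?B (n - k, j)) = (descent_bottom (Suc k) out j \<noteq> None)"
      using route_fits(2)[OF f] route_descent_bottom[OF fw t[OF k] \<open>1 \<le> j\<close> nb e] by simp
    then show ?thesis using e by simp
  qed
  have row: "meets_left (?B (i, j)) = ((i, j) \<in> D)" "meets_right (?B (i, j)) = ((i, Suc j) \<in> D)"
    if "i \<in> {1..n}" "j \<in> {1..n - 1}" for i j
    using edges[of "n - i" j] that by (auto simp: row_cells_def)
  have "tiling n (n - 1) ?B"
    unfolding tiling_def
  proof (intro conjI ballI allI impI)
    fix x assume "x \<notin> grid n (n - 1)"
    then show "?B x = Blank" by (cases x) (simp add: bvpd_of_def)
  next
    fix i j assume "i \<in> {1..n}" "j \<in> {1..<n - 1}"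
    then show "meets_right (?B (i, j)) = meets_left (?B (i, j + 1))" by (simp add: row)
  next
    fix i j assume ij: "i \<in> {1..<n}" "j \<in> {1..n - 1}"
    define k where "k = n - Suc i"
    have k: "n - i = Suc k" "Suc k < n" "n - Suc k = i" "n - k = i + 1"
      using ij by (auto simp: k_def)
    then show "meets_bottom (?B (i, j)) = meets_top (?B (i + 1, j))"
      using edges[of "Suc k" j] edges[of k j] k ij by auto
  next
    fix i assume i: "i \<in> {1..n}" "1 \<le> n - 1"
    have "(i, n) \<notin> D" using D i by (auto simp: staircase_def)
    then show "\<not> meets_right (?B (i, n - 1))" using row(2)[of i "n - 1"] i by simp
  next
    fix j assume "j \<in> {1..n - 1}" "1 \<le> n"
    then show "\<not> meets_bottom (?B (n, j))" using edges[of 0 j] by (auto simp: descent_bottom_def)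
  qed
  moreover have "?B x \<in> {Blank, HTile, Cross, JTile, RTile}" for x
    by (auto simp: bvpd_of_def tile_of_def split: prod.split)
  ultimately show bv: "bvpd n ?B" unfolding bvpd_def by blast
  show "wty_BVPD n ?B = D"
  proof -
    have "(i, j) \<in> wty_BVPD n ?B \<longleftrightarrow> (i, j) \<in> D" for i j
    proof (cases "(i, j) \<in> grid n (n - 1)")
      case True
      then show ?thesis using wty_BVPD_iff[OF bv] row(1)[of i j] by (simp add: grid_def)
    next
      case False
      then have "(i, j) \<notin> D" using D by (auto simp: grid_def staircase_def)
      then show ?thesis using False by (simp add: wty_BVPD_def)
    qed
    then show ?thesis by auto
  qed
qed

section \<open>Fireworks permutations and codes\<close>

lemma dec_runs_Cons: "\<exists>r rs. dec_runs (x # xs) = (x # r) # rs"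
proof (induction "x # xs" arbitrary: x xs rule: dec_runs.induct)
  case (3 x y xs)
  then show ?case by (cases "x > y") (auto split: list.split)
qed simp

text \<open>Within a run the code keeps the entries that are smaller than their predecessor, and it puts \<open>0\<close> for
  the others, which start a run.\<close>

lemma concat_dec_runs:
  "concat (map (\<lambda>r. 0 # tl r) (dec_runs (x # xs))) =
    0 # map (\<lambda>(a, b). if b < a then b else 0) (zip (x # xs) xs)"
proof (induction "x # xs" arbitrary: x xs rule: dec_runs.induct)
  case (3 x y xs)
  obtain r rs where r: "dec_runs (y # xs) = (y # r) # rs" using dec_runs_Cons by blast
  show ?case using 3 by (cases "x > y") (auto simp: r)
qed simp

lemma dec_runs_ascent:
  assumes "Suc j < length xs" "xs ! j < xs ! Suc j"
  shows "xs ! Suc j \<in> set (map hd (tl (dec_runs xs)))"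
  using assms
proof (induction xs arbitrary: j rule: dec_runs.induct)
  case (3 x y xs)
  obtain r rs where r: "dec_runs (y # xs) = (y # r) # rs" using dec_runs_Cons by blast
  show ?case
  proof (cases j)
    case 0
    then show ?thesis using 3 by (auto simp: r)
  next
    case (Suc j')
    have "(y # xs) ! Suc j' \<in> set (map hd (tl (dec_runs (y # xs))))"
      using 3 Suc by (cases "x > y") auto
    then show ?thesis using Suc by (cases "x > y") (auto simp: r)
  qed
qed auto

text \<open>An ascent top starts a run, so it exceeds the first entries of all earlier runs, and these bound
  their runs.\<close>

lemma sorted_dec_runs_ascent:
  assumes "sorted_wrt (<) (map hd (dec_runs xs))"
    and "Suc j < length xs" "xs ! j < xs ! Suc j" "q \<le> j"
  shows "xs ! q < xs ! Suc j"
  using assms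
proof (induction xs arbitrary: j q rule: dec_runs.induct)
  case (3 x y xs)
  obtain r rs where r: "dec_runs (y # xs) = (y # r) # rs" using dec_runs_Cons by blast
  have tail: "sorted_wrt (<) (map hd (dec_runs (y # xs)))"
    using 3(3) by (cases "x > y") (auto simp: r)
  show ?case
  proof (cases q)
    case 0
    have "(x # y # xs) ! Suc j \<in> set (map hd (tl (dec_runs (x # y # xs))))"
      using 3(4,5) by (rule dec_runs_ascent)
    moreover obtain r' rs' where D: "dec_runs (x # y # xs) = (x # r') # rs'" using dec_runs_Cons by blast
    ultimately show ?thesis using 3(3) 0 unfolding D by auto
  next
    case (Suc q')
    then obtain j' where j': "j = Suc j'" using 3(6) by (cases j) auto
    have j'': "Suc j' < length (y # xs)" "(y # xs) ! j' < (y # xs) ! Suc j'" "q' \<le> j'"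
      using 3(4-6) Suc j' by auto
    have "(y # xs) ! q' < (y # xs) ! Suc j'"
      using 3(1)[OF _ tail j''] 3(2)[OF _ tail j''] by blast
    then show ?thesis using Suc j' by simp
  qed
qed auto

lemma fireworks_ascents_lr_max:
  assumes "fireworks n u"
  shows "ascents_lr_max n u"
  unfolding ascents_lr_max_def lr_max_def
proof (intro ballI impI)
  fix j q assume j: "j \<in> {1..<n}" "u j < u (Suc j)" "q \<in> {1..<Suc j}"
  have nth: "one_line n u ! p = u (Suc p)" if "p < n" for p
    unfolding one_line_def using that by (subst nth_map_upt) auto
  obtain j' q' where j': "j = Suc j'" "q = Suc q'" using j by (cases j; cases q) auto
  then have "Suc j' < n" "q' \<le> j'" using j by auto
  have "one_line n u ! j' < one_line n u ! Suc j'"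
    using nth \<open>Suc j' < n\<close> j(2) j' by simp
  then have "one_line n u ! q' < one_line n u ! Suc j'"
    using sorted_dec_runs_ascent[of "one_line n u" j' q'] assms \<open>Suc j' < n\<close> \<open>q' \<le> j'\<close>
    by (simp add: fireworks_def one_line_def del: upt_Suc)
  then show "u q < u (Suc j)" using nth \<open>Suc j' < n\<close> \<open>q' \<le> j'\<close> j' by simp
qed

lemma alpha_eq:
  assumes "n \<ge> 1"
  shows "alpha n w = map (\<lambda>c. case descent_bottom n (inv w) c of None \<Rightarrow> 0 | Some r \<Rightarrow> r) [1..<n]"
proof -
  obtain x xs where x: "one_line n (inv w) = x # xs" using assms by (cases "one_line n (inv w)") (auto simp: one_line_def)
  have xs: "xs = map (inv w) [2..<n + 1]"
    using x assms by (simp add: one_line_def upt_conv_Cons numeral_2_eq_2 del: upt_Suc)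
  have "alpha n w = map (\<lambda>(a, b). if b < a then b else 0) (zip (one_line n (inv w)) xs)"
    by (simp add: alpha_def x concat_dec_runs)
  also have "\<dots> = map (\<lambda>c. case descent_bottom n (inv w) c of None \<Rightarrow> 0 | Some r \<Rightarrow> r) [1..<n]"
    unfolding xs one_line_def
    by (rule nth_equalityI) (auto simp: descent_bottom_def simp del: upt_Suc)
  finally show ?thesis .
qed

text \<open>Let \<open>p\<close> be the first position where \<open>s\<close> and \<open>u\<close> could differ, and suppose \<open>s p < u p\<close>. The value \<open>s p\<close>
  occurs in \<open>u\<close> only after \<open>p\<close>, and not as a descent bottom, as those are shared; so it is a
  left-to-right maximum of \<open>u\<close> and exceeds \<open>u p\<close>.\<close>

lemma descent_bottoms_determine_le:
  assumes im: "s ` {1..n} = u ` {1..n}" and inj: "inj_on s {1..n}"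
    and fs: "ascents_lr_max n s" and fu: "ascents_lr_max n u" and iu: "inj_on u {1..n}"
    and eq: "\<And>c. c \<in> {1..<n} \<Longrightarrow> descent_bottom n s c = descent_bottom n u c"
    and p: "p \<in> {1..n}" and before: "\<And>q. q \<in> {1..<p} \<Longrightarrow> s q = u q"
  shows "u p \<le> s p"
proof (rule ccontr)
  have first: "lr_max u q \<or> s q = u q" if "q \<in> {1..n}" for q
  proof (cases "q = 1 \<or> u (q - 1) < u q")
    case True
    then show ?thesis using fu that unfolding ascents_lr_max_def
      by (cases q) (force simp: lr_max_def)+
  next
    case False
    then have q: "q - 1 \<in> {1..<n}" "Suc (q - 1) = q" using that by auto
    moreover have "u q \<noteq> u (q - 1)" using inj_onD[OF iu, of q "q - 1"] q that by auto
    ultimately have "descent_bottom n u (q - 1) = Some (u q)" using False by (auto simp: descent_bottom_def)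
    then have "descent_bottom n s (q - 1) = Some (u q)" using eq[OF q(1)] by simp
    then show ?thesis using q(2) by (auto simp: descent_bottom_def split: if_splits)
  qed
  assume "\<not> u p \<le> s p"
  then have less: "s p < u p" by simp
  have "s p \<in> u ` {1..n}" using im p by blast
  then obtain q where q: "q \<in> {1..n}" "u q = s p" by auto
  have "q \<noteq> p" using less q by auto
  have "s q \<noteq> s p" using inj_onD[OF inj, of q p] q p \<open>q \<noteq> p\<close> by auto
  then have "\<not> q < p" using before[of q] q by auto
  then have "p < q" using \<open>q \<noteq> p\<close> by simp
  have "lr_max u q" using first[OF q(1)] q(2) \<open>s q \<noteq> s p\<close> by simp
  then have "u p < u q" using \<open>p < q\<close> p by (auto simp: lr_max_def)
  then show False using less q by simp
qed

lemma descent_bottoms_determine: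
  assumes im: "s ` {1..n} = {1..n}" "u ` {1..n} = {1..n::nat}"
    and fw: "ascents_lr_max n s" "ascents_lr_max n u"
    and eq: "\<And>c. c \<in> {1..<n} \<Longrightarrow> descent_bottom n s c = descent_bottom n u c"
    and p: "p \<in> {1..n}"
  shows "s p = u p"
  using p
proof (induction p rule: less_induct)
  case (less p)
  have inj: "inj_on s {1..n}" "inj_on u {1..n}" using im by (auto intro!: eq_card_imp_inj_on)
  have before: "s q = u q" if "q \<in> {1..<p}" for q using less that by auto
  show ?case
  proof (rule antisym)
    show "u p \<le> s p"
      using descent_bottoms_determine_le[of s n u p] im inj fw eq less.prems before by simp
    show "s p \<le> u p"
      using descent_bottoms_determine_le[of u n s p] im inj fw eq[symmetric] less.prems before[symmetric] by simp
  qed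
qed

section \<open>The bijection\<close>

definition tight_sets :: "nat \<Rightarrow> (nat \<Rightarrow> nat) \<Rightarrow> (nat \<times> nat) set set" where
  "tight_sets n u = {D. D \<subseteq> staircase n \<and>
     (\<forall>k<n. tight k (row_cells n D k) (state n (row_cells n D) k)) \<and>
     (\<forall>c\<in>{1..n}. state n (row_cells n D) n c = u c)}"

text \<open>Injective since the weighty cells and the words they produce determine all strands. The code of a
  bumpless tiling is \<open>alpha n w\<close> iff the final word has the descent bottoms of \<open>inv w\<close>; both words being
  fireworks permutations, they are then equal.\<close>

lemma bij_betw_wty_BVPD:
  assumes n: "n \<ge> 1" and w: "w permutes {1..n}" and fw: "inverse_fireworks n w"
  shows "bij_betw (wty_BVPD n) (BVPD n w) (tight_sets n (inv w))"
proof (rule bij_betwI')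
  fix B B' assume "B \<in> BVPD n w" "B' \<in> BVPD n w"
  then show "(wty_BVPD n B = wty_BVPD n B') = (B = B')"
    using bvpd_eq_bvpd_of[of n B] bvpd_eq_bvpd_of[of n B'] by (auto simp: BVPD_def)
next
  have fu: "ascents_lr_max n (inv w)"
    using fw by (intro fireworks_ascents_lr_max) (simp add: inverse_fireworks_def)
  have iu: "inv w ` {1..n} = {1..n}" using permutes_image[OF permutes_inv[OF w]] .
  have code: "column_to_row_code n B =
      map (\<lambda>c. case descent_bottom n (state n (row_cells n (wty_BVPD n B)) n) c of None \<Rightarrow> 0 | Some r \<Rightarrow> r) [1..<n]"
    if "bvpd n B" for B
    using that route_state_bvpd[OF that order_refl]
    by (simp add: column_to_row_code_def exit_pipe_route bvpd_def)
  {
    fix B assume "B \<in> BVPD n w"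
    then have B: "bvpd n B" and c: "column_to_row_code n B = alpha n w" by (auto simp: BVPD_def)
    let ?R = "row_cells n (wty_BVPD n B)"
    note D = wty_BVPD_staircase[OF B]
    have R: "\<And>k. k < n \<Longrightarrow> ?R k \<subseteq> {1..k}" by (rule row_cells_staircase[OF D])
    have t: "tight k (?R k) (state n ?R k)" if "k < n" for k
      using route_state_bvpd[OF B order_refl] that by simp
    have fs: "ascents_lr_max n (state n ?R n)" by (intro ascents_lr_max_state R t) auto
    have im: "state n ?R n ` {1..n} = {1..n}" using state_image[of n ?R n] R by simp
    have pos: "descent_bottom n s c \<noteq> Some 0" if "s ` {1..n} = {1..n}" for s and c :: nat
    proof
      assume "descent_bottom n s c = Some 0"
      then have "Suc c \<in> {1..n}" "s (Suc c) = 0" by (auto simp: descent_bottom_def split: if_splits)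
      then show False using that by (metis atLeastAtMost_iff imageI not_one_le_zero)
    qed
    have eq: "descent_bottom n (state n ?R n) c = descent_bottom n (inv w) c" if "c \<in> {1..<n}" for c
    proof -
      have "(case descent_bottom n (state n ?R n) c of None \<Rightarrow> 0 | Some r \<Rightarrow> r) =
          (case descent_bottom n (inv w) c of None \<Rightarrow> 0 | Some r \<Rightarrow> r)"
        using c that unfolding code[OF B] alpha_eq[OF n] by auto
      then show ?thesis using pos[OF im, of c] pos[OF iu, of c] by (auto split: option.splits)
    qed
    have "state n ?R n c = inv w c" if "c \<in> {1..n}" for c
      using descent_bottoms_determine[OF im iu fs fu eq that] .
    then show "wty_BVPD n B \<in> tight_sets n (inv w)" using D t by (simp add: tight_sets_def)
  }
  fix D assume "D \<in> tight_sets n (inv w)"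
  then have D: "D \<subseteq> staircase n" and t: "\<And>k. k < n \<Longrightarrow> tight k (row_cells n D k) (state n (row_cells n D) k)"
    and s: "\<And>c. c \<in> {1..n} \<Longrightarrow> state n (row_cells n D) n c = inv w c"
    by (auto simp: tight_sets_def)
  note B = bvpd_of_bvpd[OF D t]
  have "descent_bottom n (state n (row_cells n D) n) c = descent_bottom n (inv w) c" for c
    using s by (auto simp: descent_bottom_def)
  then have "bvpd_of n D \<in> BVPD n w"
    using B by (simp add: BVPD_def code alpha_eq[OF n])
  then show "\<exists>B\<in>BVPD n w. D = wty_BVPD n B" using B(2) by auto
qed

lemma card_row_cells:
  assumes D: "D \<subseteq> staircase n"
  shows "(\<Sum>k<n. card ({1..k} - row_cells n D k)) + card D = (\<Sum>k<n. k)"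
proof -
  have R: "row_cells n D k \<subseteq> {1..k}" if "k < n" for k using row_cells_staircase[OF D that] .
  have "D = (\<lambda>(k, j). (n - k, j)) ` Sigma {..<n} (row_cells n D)"
  proof
    show "D \<subseteq> (\<lambda>(k, j). (n - k, j)) ` Sigma {..<n} (row_cells n D)"
    proof
      fix x assume "x \<in> D"
      then obtain i j where "x = (i, j)" "1 \<le> i" "i \<le> n" "(i, j) \<in> D"
        using D by (auto simp: staircase_def)
      then show "x \<in> (\<lambda>(k, j). (n - k, j)) ` Sigma {..<n} (row_cells n D)"
        by (intro image_eqI[of _ _ "(n - i, j)"]) (auto simp: row_cells_def)
    qed
  qed (auto simp: row_cells_def)
  moreover have "inj_on (\<lambda>(k, j). (n - k, j)) (Sigma {..<n} (row_cells n D))"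
    by (auto simp: inj_on_def)
  ultimately have "card D = card (Sigma {..<n} (row_cells n D))"
    by (metis card_image)
  also have "\<dots> = (\<Sum>k<n. card (row_cells n D k))"
    using R by (intro card_SigmaI) (auto intro: finite_subset)
  finally have "(\<Sum>k<n. card ({1..k} - row_cells n D k)) + card D =
      (\<Sum>k<n. card ({1..k} - row_cells n D k) + card (row_cells n D k))"
    by (simp add: sum.distrib)
  also have "\<dots> = (\<Sum>k<n. k)"
  proof (rule sum.cong)
    fix k assume "k \<in> {..<n}"
    then have r: "row_cells n D k \<subseteq> {1..k}" using R by simp
    then have "card (row_cells n D k) \<le> card {1..k}" by (intro card_mono) auto
    then show "card ({1..k} - row_cells n D k) + card (row_cells n D k) = k"
      using card_Diff_subset[OF finite_subset[OF r] r] by simp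
  qed simp
  finally show ?thesis .
qed

lemma tight_sets_nonempty:
  assumes "u ` {1..n} = {1..n}" "ascents_lr_max n u"
  shows "tight_sets n u \<noteq> {}"
proof -
  obtain R where R: "\<And>k. k < n \<Longrightarrow> R k \<subseteq> {1..k} \<and> tight k (R k) (state n R k)"
    "\<And>c. c \<in> {1..n} \<Longrightarrow> state n R n c = u c"
  proof -
    have "u ` {1..n} = {Suc (n - n)..n}" using assms(1) by simp
    from tight_rows_exist[OF this order_refl assms(2)] show thesis using that by blast
  qed
  define D where "D = {(n - k, j) | k j. k < n \<and> j \<in> R k}"
  have rc: "row_cells n D k = R k" if "k < n" for k
    using that by (auto simp: row_cells_def D_def) (metis diff_diff_cancel less_imp_le)
  then have st: "state n (row_cells n D) k = state n R k" if "k \<le> n" for k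
    using that by (intro state_cong) auto
  have "D \<subseteq> staircase n" using R(1) by (fastforce simp: D_def staircase_def)
  then have "D \<in> tight_sets n u" using R rc st by (simp add: tight_sets_def)
  then show ?thesis by blast
qed

text \<open>All pipe dreams of \<open>w\<close> end in the word \<open>inv w\<close>, so the weight of \<open>inv w\<close> bounds their number of bumps
  from below. As \<open>inv w\<close> is fireworks, the bound is attained, and the maximal pipe dreams are those attaining
  it.\<close>

lemma PD_hat_eq_tight_sets:
  assumes w: "w permutes {1..n}" and fw: "inverse_fireworks n w"
  shows "PD_hat n w = dream_of n ` tight_sets n (inv w)"
proof -
  let ?u = "inv w"
  have bound: "lr_weight n ?u + card D \<le> (\<Sum>k<n. k)"
    "lr_weight n ?u + card D = (\<Sum>k<n. k) \<longleftrightarrow> D \<in> tight_sets n ?u"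
    if D: "D \<subseteq> staircase n" "dream_of n D \<in> PD n w" for D
  proof -
    let ?R = "row_cells n D"
    have s: "\<forall>c\<in>{1..n}. state n ?R n c = ?u c" using D dream_of_in_PD by blast
    have "lr_max (state n ?R n) p = lr_max ?u p" if "p \<in> {1..n}" for p
      using s that by (intro lr_max_cong) auto
    then have "lr_weight n (state n ?R n) = lr_weight n ?u" by (simp add: lr_weight_def)
    then show "lr_weight n ?u + card D \<le> (\<Sum>k<n. k)"
      "lr_weight n ?u + card D = (\<Sum>k<n. k) \<longleftrightarrow> D \<in> tight_sets n ?u"
      using lr_weight_state[of n ?R n, OF row_cells_staircase[OF D(1)] order_refl]
        card_row_cells[OF D(1)] s D(1)
      unfolding tight_sets_def by auto
  qed
  have tight_PD: "D \<subseteq> staircase n \<and> dream_of n D \<in> PD n w" if "D \<in> tight_sets n ?u" for D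
    using that dream_of_in_PD by (auto simp: tight_sets_def)
  have PD: "\<exists>D. D \<subseteq> staircase n \<and> P = dream_of n D \<and> wty_PD n P = D" if "P \<in> PD n w" for P
    using that pipe_dream_eq_dream_of[of n P] by (auto simp: PD_def)
  obtain D0 where D0: "D0 \<in> tight_sets n ?u"
    using tight_sets_nonempty[of ?u n] permutes_image[OF permutes_inv[OF w]] fw
    by (auto simp: inverse_fireworks_def intro: fireworks_ascents_lr_max)
  show ?thesis
  proof
    show "PD_hat n w \<subseteq> dream_of n ` tight_sets n ?u"
    proof
      fix P assume P: "P \<in> PD_hat n w"
      then obtain D where D: "D \<subseteq> staircase n" "P = dream_of n D" "wty_PD n P = D" "dream_of n D \<in> PD n w"
        using PD[of P] by (auto simp: PD_hat_def)
      have "card D0 \<le> card D"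
        using P D tight_PD[OF D0] wty_PD_dream_of[of D0 n] by (force simp: PD_hat_def)
      then have "D \<in> tight_sets n ?u"
        using bound[OF D(1,4)] bound(2)[of D0] tight_PD[OF D0] D0 by auto
      then show "P \<in> dream_of n ` tight_sets n ?u" using D(2) by simp
    qed
    show "dream_of n ` tight_sets n ?u \<subseteq> PD_hat n w"
    proof
      fix P assume "P \<in> dream_of n ` tight_sets n ?u"
      then obtain D where D: "D \<in> tight_sets n ?u" "P = dream_of n D" by auto
      have "card (wty_PD n Q) \<le> card (wty_PD n P)" if "Q \<in> PD n w" for Q
      proof -
        obtain E where E: "E \<subseteq> staircase n" "Q = dream_of n E" "wty_PD n Q = E"
          using PD[OF \<open>Q \<in> PD n w\<close>] by auto
        have "card E \<le> card D" using bound(1)[of E] bound(2)[of D] E that tight_PD[OF D(1)] D(1) by auto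
        then show ?thesis using E D tight_PD[OF D(1)] wty_PD_dream_of[of D n] by auto
      qed
      then show "P \<in> PD_hat n w" using tight_PD[OF D(1)] D(2) by (simp add: PD_hat_def)
    qed
  qed
qed

theorem theorem4p4:
  fixes n :: nat and w :: "nat \<Rightarrow> nat"
  assumes "n \<ge> 1"
    and "w permutes {1..n}"
    and "inverse_fireworks n w"
  shows "\<exists>\<Psi>. bij_betw \<Psi> (BVPD n w) (PD_hat n w) \<and>
           (\<forall>B\<in>BVPD n w. wty_PD n (\<Psi> B) = wty_BVPD n B)"
proof (intro exI conjI ballI)
  let ?\<Psi> = "dream_of n \<circ> wty_BVPD n"
  have wty: "wty_PD n (dream_of n D) = D" if "D \<in> tight_sets n (inv w)" for D
    using that by (intro wty_PD_dream_of) (simp add: tight_sets_def)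
  have "bij_betw (dream_of n) (tight_sets n (inv w)) (PD_hat n w)"
    unfolding bij_betw_def PD_hat_eq_tight_sets[OF assms(2,3)]
    using inj_on_inverseI[of _ "wty_PD n" "dream_of n"] wty by blast
  then show "bij_betw ?\<Psi> (BVPD n w) (PD_hat n w)"
    using bij_betw_wty_BVPD[OF assms] by (rule bij_betw_trans[rotated])
  fix B assume "B \<in> BVPD n w"
  then have "wty_BVPD n B \<in> tight_sets n (inv w)"
    using bij_betw_wty_BVPD[OF assms] by (auto simp: bij_betw_def)
  then show "wty_PD n (?\<Psi> B) = wty_BVPD n B" by (simp add: wty)
qed

end
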